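(* Let $f:\mathbb{R}^n\to\mathbb{R}$ be a Borel measurable function and $0<\varepsilon\le1$. Let $s\le1$ and let $\mu$ be an $s$-concave probability measure on $\mathbb{R}^n$. Let $\lambda<\|f\|_{L^\infty(\mu)}$. Then $$\mu(\{|f|\le\lambda\varepsilon\})\le\delta_f(\varepsilon)\times\frac{1-\mu(\{|f|\ge\lambda\})^s}{s}.$$ In particular, if $\mu$ is log-concave (i.e. for $s=0$, where the right-hand side above is interpreted by continuity), then $$\mu(\{|f|\le\lambda\varepsilon\})\le\delta_f(\varepsilon)\times\log\bigl(1/\mu(\{|f|\ge\lambda\})\bigr).$$
   Context: The modulus of regularity of $f$ is $$\delta_f(\varepsilon)=\sup_{x,y\in\mathbb{R}^n}\bigl|\{\alpha\in[0,1]:\ |f((1-\alpha)x+\alpha y)|\le\varepsilon|f(x)|\}\bigr|,\qquad 0<\varepsilon\le1,$$ where $|\cdot|$ applied to a subset of $[0,1]$ is Lebesgue measure. $\|f\|_{L^\infty(\mu)}$ is the $\mu$-essential supremum of $|f|$. For $s\in(-\infty,1]$, a (Borel) measure $\mu$ on $\mathbb{R}^n$ is $s$-concave if $$\mu(\alpha A+(1-\alpha)B)\ge[\alpha\mu(A)^s+(1-\alpha)\mu(B)^s]^{1/s}$$ for all compact $A,B\subset\mathbb{R}^n$ with $\mu(A)\mu(B)>0$ and all $\alpha\in[0,1]$, where $\alpha A+(1-\alpha)B=\{\alpha x+(1-\alpha)y: x\in A,\ y\in B\}$; for $s=0$ the right-hand side is interpreted as $\mu(A)^\alpha\mu(B)^{1-\alpha}$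 (log-concave).
   Formalization: If λ = 0 or ε = 1, the formal theorem additionally assumes μ({|f| = λ}) = 0; without this the claim fails, e.g. λ = 0, μ uniform on [−1,1], f the indicator of (0,∞), or ε = 1, λ = 1, μ uniform on [0,1], f = 1 on (−∞,1/2] and 2 beyond. *)

theory Defs
  imports "HOL-Probability.Probability"
begin

text \<open>The supremum is over values in the interval from 0 to 1 whenever \<open>f\<close> is Borel,
  so the conditionally complete \<open>SUP\<close> on the reals is the intended one. The degenerate
  pairs \<open>x = y\<close> are included.\<close>

definition regularity_modulus :: "(real ^ 'n \<Rightarrow> real) \<Rightarrow> real \<Rightarrow> real" where
  "regularity_modulus f \<epsilon> =
     (SUP (x, y)\<in>UNIV. measure lebesgue
        {\<alpha> \<in> {0..1}. \<bar>f ((1 - \<alpha>) *\<^sub>R x + \<alpha> *\<^sub>R y)\<bar> \<le> \<epsilon> * \<bar>f x\<bar>})"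

text \<open>Used only for \<open>a, b > 0\<close>, where \<open>powr\<close> is the usual real power.\<close>

definition power_mean :: "real \<Rightarrow> real \<Rightarrow> real \<Rightarrow> real \<Rightarrow> real" where
  "power_mean s \<alpha> a b =
     (if s = 0 then a powr \<alpha> * b powr (1 - \<alpha>)
      else (\<alpha> * a powr s + (1 - \<alpha>) * b powr s) powr (1 / s))"

text \<open>Intended for Borel measures that are finite on compact sets, where the real-valued
  \<open>measure\<close> of a compact set carries the same information as \<open>emeasure\<close>.\<close>

definition s_concave :: "real \<Rightarrow> (real ^ 'n) measure \<Rightarrow> bool" where
  "s_concave s M \<longleftrightarrow>
     (\<forall>A B. compact A \<longrightarrow> compact B \<longrightarrow> measure M A * measure M B > 0 \<longrightarrow>
       (\<forall>\<alpha>\<in>{0..1}.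
          measure M {\<alpha> *\<^sub>R x + (1 - \<alpha>) *\<^sub>R y | x y. x \<in> A \<and> y \<in> B}
            \<ge> power_mean s \<alpha> (measure M A) (measure M B)))"

end

theory Submission imports Defs begin

text \<open>
  Write \<open>A = {|f| \<ge> \<lambda>}\<close> and \<open>F = {|f| \<le> \<lambda>\<epsilon>}\<close>. Every segment starting at a point of \<open>A\<close> spends at most the
  fraction \<open>\<delta> = \<delta>\<^sub>f(\<epsilon>)\<close> of its length in \<open>F\<close>. After shrinking \<open>A\<close> and \<open>F\<close> to disjoint compact sets, suppose the
  bound fails. Bisecting by hyperplanes yields convex bodies, shrinking to a segment, on which
  \<open>A\<close> keeps at least its proportion of the mass and \<open>F\<close> still violates the bound. Instead of passing to a
  limit measure, one slightly fattens the traces of \<open>A\<close> and \<open>F\<close> on the segment and projects a nearby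
  body to the line; this contradicts the one-dimensional inequality.

  On the line, \<open>F\<close> lies in finitely many gaps of \<open>A\<close>. In a gap with \<open>A\<close> only on the left, the
  \<open>s\<close>-transform of the normalised distribution function is concave, hence loses at most the fraction
  \<open>\<delta>\<close> of its increment to \<open>F\<close>, since every initial interval of the gap does so in length. Cutting a gap where
  both sides see the same proportion of outer mass reduces to this case, and
  \<open>x \<mapsto> (1 - (1 - x)\<^sup>s)/s\<close> is superadditive, so the gaps can be summed.
\<close>

text \<open>Both conditions carried through the bisection compare masses inside one body:
  \<open>A\<close> has at least the fraction \<open>p\<close>, its mass in the whole space, and
  \<open>F\<close> more than a fraction \<kappa> chosen strictly between the claimed bound and the
  mass of \<open>F\<close>. This strictness pays for leaving the segment. Writing \<kappa> as
  \<delta>' times \<open>- lg s p\<close> gives \<delta>' > \<delta>, and the length condition for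
  the fattened traces has to hold only with \<delta>'. The condition in space is used only along the
  line of the segment; a nearby body merely has to project its parts of \<open>A\<close> and
  \<open>F\<close> into the fattened traces.

  The obstacle to bisecting is mass on hyperplanes, since an s-concave measure may live on a proper
  affine subspace. Hence all bodies are taken inside one of least dimension. Measures have no
  densities here: on the line, concavity is applied to closed half-lines and, to deal with atoms, to
  compact intervals.\<close>

section \<open>The concave transform and power means\<close>

text \<open>The primitive of \<open>x powr (s - 1)\<close> that vanishes at 1. It is increasing for
  every sign of \<open>s\<close>, so no case distinction on \<open>s\<close> is needed later; the
  last factor in the theorem is \<open>- lg s\<close> of the mass of the tail.\<close>

definition lg :: "real \<Rightarrow> real \<Rightarrow> real" where
  "lg s x = (if s = 0 then ln x else (x powr s - 1) / s)"

lemma lg_one [simp]: "lg s 1 = 0"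
  by (simp add: lg_def)

lemma lg_has_derivative:
  "0 < x \<Longrightarrow> (lg s has_real_derivative x powr (s - 1)) (at x)"
proof (cases "s = 0")
  case True
  assume "0 < x"
  then have "(ln has_real_derivative x powr (s - 1)) (at x)"
    by (auto intro!: derivative_eq_intros simp: True powr_minus divide_inverse)
  then show ?thesis
    by (simp add: lg_def [abs_def] True)
next
  case False
  assume "0 < x"
  then have "((\<lambda>x. (x powr s - 1) / s) has_real_derivative x powr (s - 1)) (at x)"
    using False by (auto intro!: derivative_eq_intros)
  then show ?thesis
    by (simp add: lg_def [abs_def] False)
qed

lemma continuous_lg: "0 < x \<Longrightarrow> isCont (lg s) x"
  using DERIV_isCont lg_has_derivative by blast

lemma lg_strict_mono:
  assumes "0 < x" "x < y"
  shows "lg s x < lg s y"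
proof (rule DERIV_pos_imp_increasing [OF assms(2)])
  fix z assume "x \<le> z"
  then show "\<exists>d. (lg s has_real_derivative d) (at z) \<and> 0 < d"
    using assms lg_has_derivative [of z s] by (intro exI [of _ "z powr (s - 1)"]) auto
qed

lemma lg_mono: "0 < x \<Longrightarrow> x \<le> y \<Longrightarrow> lg s x \<le> lg s y"
  using lg_strict_mono [of x y s] by (cases "x = y") auto

lemma lg_le_iff: "0 < x \<Longrightarrow> 0 < y \<Longrightarrow> lg s x \<le> lg s y \<longleftrightarrow> x \<le> y"
  by (meson lg_mono lg_strict_mono not_le)

text \<open>Under \<open>lg s\<close>, division by \<open>m\<close> becomes an affine map of
  positive slope, so concavity statements survive normalisation of the measure.\<close>

lemma lg_scale:
  assumes "0 < x" "0 < m"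
  shows "lg s (x / m) = m powr (- s) * (lg s x - lg s m)"
  using assms by (auto simp: lg_def ln_div powr_divide powr_minus field_simps)

text \<open>For \<open>s \<le> 1\<close> the derivative \<open>z powr (s - 1)\<close> is at least 1
  on (0, 1].\<close>

lemma lg_diff_ge:
  assumes "s \<le> 1" "0 < x" "x \<le> y" "y \<le> 1"
  shows "y - x \<le> lg s y - lg s x"
proof -
  have "lg s x - x \<le> lg s y - y"
  proof (rule DERIV_nonneg_imp_nondecreasing [OF assms(3)])
    fix z assume z: "x \<le> z" "z \<le> y"
    have "((\<lambda>x. lg s x - x) has_real_derivative z powr (s - 1) - 1) (at z)"
      using z assms by (auto intro!: derivative_eq_intros lg_has_derivative)
    moreover have "1 \<le> z powr (s - 1)"
      using powr_mono' [of "s - 1" 0 z] z assms by auto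
    ultimately show "\<exists>d. ((\<lambda>x. lg s x - x) has_real_derivative d) (at z) \<and> 0 \<le> d"
      by force
  qed
  then show ?thesis by simp
qed

text \<open>The derivative of \<open>lg s\<close> is decreasing for \<open>s \<le> 1\<close>, so the
  increment over a step of length x grows as the step moves to the left. Compare the steps ending at
  1 and at 1 - y.\<close>

lemma lg_subadd:
  assumes "s \<le> 1" "0 \<le> x" "0 \<le> y" "x + y < 1"
  shows "lg s (1 - (x + y)) \<le> lg s (1 - x) + lg s (1 - y)"
proof -
  have "lg s 1 - lg s (1 - x) \<le> lg s (1 - y) - lg s (1 - y - x)"
  proof (rule DERIV_nonpos_imp_nonincreasing [where f = "\<lambda>t. lg s t - lg s (t - x)"])
    show "1 - y \<le> 1" using assms by simp
    fix t assume t: "1 - y \<le> t" "t \<le> 1"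
    have "((\<lambda>t. lg s (t - x)) has_real_derivative (t - x) powr (s - 1) * 1) (at t)"
      using t assms
      by (intro DERIV_chain2 [where f = "lg s"] lg_has_derivative) (auto intro!: derivative_eq_intros)
    then have "((\<lambda>t. lg s t - lg s (t - x)) has_real_derivative t powr (s - 1) - (t - x) powr (s - 1)) (at t)"
      using t assms
      by (auto intro!: derivative_eq_intros lg_has_derivative)
    moreover have "t powr (s - 1) \<le> (t - x) powr (s - 1)"
      using t assms by (intro powr_mono2') auto
    ultimately show "\<exists>d. ((\<lambda>t. lg s t - lg s (t - x)) has_real_derivative d) (at t) \<and> d \<le> 0"
      by force
  qed
  then show ?thesis by (simp add: algebra_simps)
qed

lemma powr_average_pos:
  assumes "0 < a" "0 < b" "0 \<le> \<alpha>" "\<alpha> \<le> (1::real)"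
  shows "0 < \<alpha> * a powr s + (1 - \<alpha>) * b powr s"
proof (cases "\<alpha> = 0")
  case False
  then have "0 < \<alpha> * a powr s"
    using assms by simp
  then show ?thesis
    using assms by (simp add: add_pos_nonneg)
qed (use assms in simp)

lemma power_mean_pos:
  assumes "0 < a" "0 < b" "0 \<le> \<alpha>" "\<alpha> \<le> 1"
  shows "0 < power_mean s \<alpha> a b"
  using assms powr_average_pos [OF assms, of s] by (auto simp: power_mean_def)

text \<open>The power mean is the quasi-arithmetic mean generated by \<open>lg s\<close>; this is
  how concavity of a measure becomes ordinary concavity of a function.\<close>

lemma lg_power_mean:
  assumes "0 < a" "0 < b" "0 \<le> \<alpha>" "\<alpha> \<le> 1"
  shows "lg s (power_mean s \<alpha> a b) = \<alpha> * lg s a + (1 - \<alpha>) * lg s b"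
proof (cases "s = 0")
  case True
  then show ?thesis using assms by (simp add: lg_def power_mean_def ln_mult)
next
  case False
  have "0 < \<alpha> * a powr s + (1 - \<alpha>) * b powr s"
    using assms by (rule powr_average_pos)
  then show ?thesis
    using False by (simp add: lg_def power_mean_def powr_powr field_simps)
qed

lemma power_mean_ge_min:
  assumes "0 < a" "0 < b" "0 \<le> \<alpha>" "\<alpha> \<le> 1"
  shows "min a b \<le> power_mean s \<alpha> a b"
proof -
  have "\<alpha> * lg s (min a b) + (1 - \<alpha>) * lg s (min a b) \<le> \<alpha> * lg s a + (1 - \<alpha>) * lg s b"
    using assms by (intro add_mono mult_left_mono lg_mono) auto
  then have "lg s (min a b) \<le> lg s (power_mean s \<alpha> a b)"
    using assms by (simp add: lg_power_mean algebra_simps)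
  then show ?thesis
    using assms power_mean_pos [OF assms] by (simp add: lg_le_iff)
qed

text \<open>Homogeneity is checked after applying \<open>lg s\<close>, where both sides become the
  same affine expression; strict monotonicity of \<open>lg s\<close> then gives equality.\<close>

lemma power_mean_divide:
  assumes "0 < a" "0 < b" "0 \<le> \<alpha>" "\<alpha> \<le> 1" "0 < m"
  shows "power_mean s \<alpha> (a / m) (b / m) = power_mean s \<alpha> a b / m"
proof -
  have "lg s (power_mean s \<alpha> (a / m) (b / m)) = lg s (power_mean s \<alpha> a b / m)"
    using assms power_mean_pos [OF assms(1-4)]
    by (simp add: lg_power_mean lg_scale algebra_simps)
  then show ?thesis
    using assms by (intro order.antisym) (auto simp: power_mean_pos simp flip: lg_le_iff [of _ _ s])
qed

section \<open>Concave measures on the line\<close>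

text \<open>\<open>T\<close> is any closed superset of \<open>\<alpha>A + (1 - \<alpha>)B\<close>, because a Minkowski sum of unbounded closed sets need
  not be closed.\<close>

definition line_concave :: "real \<Rightarrow> real measure \<Rightarrow> bool" where
  "line_concave s N \<longleftrightarrow>
     (\<forall>A B T \<alpha>. closed A \<longrightarrow> closed B \<longrightarrow> closed T \<longrightarrow> 0 < measure N A \<longrightarrow> 0 < measure N B \<longrightarrow>
        0 \<le> \<alpha> \<longrightarrow> \<alpha> \<le> 1 \<longrightarrow> (\<forall>x\<in>A. \<forall>y\<in>B. \<alpha> * x + (1 - \<alpha>) * y \<in> T) \<longrightarrow>
        power_mean s \<alpha> (measure N A) (measure N B) \<le> measure N T)"

lemma line_concaveD:
  assumes "line_concave s N" "closed A" "closed B" "closed T" "0 < measure N A" "0 < measure N B"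
    "0 \<le> \<alpha>" "\<alpha> \<le> 1" "\<And>x y. x \<in> A \<Longrightarrow> y \<in> B \<Longrightarrow> \<alpha> * x + (1 - \<alpha>) * y \<in> T"
  shows "power_mean s \<alpha> (measure N A) (measure N B) \<le> measure N T"
  using assms unfolding line_concave_def by blast

lemma line_concave_reflect:
  assumes N: "sets N = sets borel" and "line_concave s N"
  shows "line_concave s (distr N borel uminus)"
proof -
  have me: "uminus \<in> borel_measurable N"
    using borel_measurable_uminus [OF measurable_ident_sets [OF N]] by simp
  have sp: "space N = UNIV"
    using sets_eq_imp_space_eq [OF N] by simp
  have M: "measure (distr N borel uminus) X = measure N (uminus ` X)" if "closed X" for X
    using that measure_distr [OF me borel_closed [OF that]] by (simp add: minus_image_eq_vimage sp)
  show ?thesis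
    unfolding line_concave_def
  proof (intro allI impI)
    fix A B T :: "real set" and \<alpha> :: real
    assume *: "closed A" "closed B" "closed T" "0 < measure (distr N borel uminus) A"
      "0 < measure (distr N borel uminus) B" "0 \<le> \<alpha>" "\<alpha> \<le> 1"
      "\<forall>x\<in>A. \<forall>y\<in>B. \<alpha> * x + (1 - \<alpha>) * y \<in> T"
    have "\<alpha> * x + (1 - \<alpha>) * y \<in> uminus ` T" if "x \<in> uminus ` A" "y \<in> uminus ` B" for x y
    proof -
      have "- x \<in> A" "- y \<in> B"
        using that by auto
      then have "\<alpha> * (- x) + (1 - \<alpha>) * (- y) \<in> T"
        using *(8) by blast
      then show ?thesis
        by (rule image_eqI [rotated]) (simp add: algebra_simps)
    qed
    then have "power_mean s \<alpha> (measure N (uminus ` A)) (measure N (uminus ` B)) \<le> measure N (uminus ` T)"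
      using * by (intro line_concaveD [OF assms(2)] closed_negations) (simp_all only: M)
    then show "power_mean s \<alpha> (measure (distr N borel uminus) A) (measure (distr N borel uminus) B)
        \<le> measure (distr N borel uminus) T"
      using * by (simp only: M)
  qed
qed

section \<open>Atoms of concave measures on the line\<close>

text \<open>Continuity from below along compact intervals that exhaust the open half-line. The
  interval found has positive distance from x, so copies of it shrunk towards x still avoid
  x.\<close>

lemma measure_positive_gap:
  fixes N :: "real measure"
  assumes "finite_measure N" and N: "sets N = sets borel" and "0 < measure N {x<..}"
  obtains c d where "0 < c" "c \<le> d" "0 < measure N {x + c..x + d}"
proof -
  interpret finite_measure N by fact
  have "(\<lambda>k. measure N {x + 1 / Suc k..x + Suc k}) \<longlonglongrightarrow> measure N (\<Union>k. {x + 1 / Suc k..x + Suc k})"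
  proof (rule finite_Lim_measure_incseq)
    show "incseq (\<lambda>k. {x + 1 / Suc k..x + Suc k})"
      unfolding incseq_def
    proof (intro allI impI)
      fix m n :: nat assume "m \<le> n"
      moreover have "1 / real (Suc n) \<le> 1 / Suc m"
        using \<open>m \<le> n\<close> by (intro divide_left_mono) auto
      ultimately show "{x + 1 / Suc m..x + Suc m} \<subseteq> {x + 1 / Suc n..x + Suc n}"
        by auto
    qed
  qed (simp add: N image_subset_iff)
  moreover have "(\<Union>k. {x + 1 / Suc k..x + Suc k}) = {x<..}"
  proof (intro equalityI subsetI)
    fix y assume "y \<in> {x<..}"
    then have "0 < y - x" by simp
    obtain m where m: "1 / Suc m < y - x"
      using reals_Archimedean [OF \<open>0 < y - x\<close>] by (metis inverse_eq_divide)
    obtain n where n: "y - x < real n"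
      using reals_Archimedean2 by blast
    have "1 / Suc (max m n) \<le> 1 / Suc m"
      by (intro divide_left_mono) auto
    moreover have "real n \<le> Suc (max m n)" by simp
    ultimately have "y \<in> {x + 1 / Suc (max m n)..x + Suc (max m n)}"
      using m n by simp
    then show "y \<in> (\<Union>k. {x + 1 / Suc k..x + Suc k})"
      by blast
  next
    fix y assume "y \<in> (\<Union>k. {x + 1 / Suc k..x + Suc k})"
    then obtain k where "x + 1 / Suc k \<le> y" by auto
    moreover have "0 < 1 / real (Suc k)" by simp
    ultimately show "y \<in> {x<..}" unfolding greaterThan_iff by linarith
  qed
  ultimately have "(\<lambda>k. measure N {x + 1 / Suc k..x + Suc k}) \<longlonglongrightarrow> measure N {x<..}"
    by simp
  from order_tendstoD(1) [OF this assms(3)]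
  obtain k where "0 < measure N {x + 1 / Suc k..x + Suc k}"
    unfolding eventually_sequentially by blast
  moreover have "1 / real (Suc k) \<le> Suc k"
    by (simp add: field_simps)
  ultimately show thesis
    by (intro that [of "1 / Suc k" "Suc k"]) simp_all
qed

text \<open>Averaging an interval of positive mass to the right of x with the atom at x gives copies
  arbitrarily close to x. Each has at least the smaller of the two masses, because a power mean is
  at least the minimum; this contradicts right continuity of the distribution function at x.\<close>

lemma line_concave_atom_aux:
  fixes N :: "real measure"
  assumes "finite_measure N" and N: "sets N = sets borel" and conc: "line_concave s N"
    and atom: "0 < measure N {x}"
  shows "measure N {x<..} = 0"
proof (rule ccontr)
  interpret finite_measure N by fact
  interpret finite_borel_measure N
    by unfold_locales (rule N)
  assume "measure N {x<..} \<noteq> 0"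
  then have "0 < measure N {x<..}"
    using measure_nonneg [of N "{x<..}"] by linarith
  with measure_positive_gap [OF assms(1,2)]
  obtain c d where cd: "0 < c" "c \<le> d" "0 < measure N {x + c..x + d}"
    by blast
  define e where "e = min (measure N {x + c..x + d}) (measure N {x})"
  have "0 < e"
    using cd atom by (simp add: e_def)
  have ge: "e \<le> cdf N (x + h) - cdf N x" if "0 < h" "h \<le> d" for h
  proof -
    have "x + h / d * c > x" using that cd by simp
    have "e \<le> power_mean s (h / d) (measure N {x + c..x + d}) (measure N {x})"
      unfolding e_def using that cd atom by (intro power_mean_ge_min) auto
    also have "\<dots> \<le> measure N {x + h / d * c..x + h}"
    proof (rule line_concaveD [OF conc])
      fix u y assume "u \<in> {x + c..x + d}" "y \<in> {x}"
      then have "c \<le> u - x" "u - x \<le> d" "y = x" by auto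
      then have "h / d * c \<le> h / d * (u - x)" "h / d * (u - x) \<le> h / d * d"
        using that by (simp_all add: mult_left_mono del: times_divide_eq_left)
      moreover have "h / d * d = h" using that by simp
      moreover have "h / d * u + (1 - h / d) * y = x + h / d * (u - x)"
        using \<open>y = x\<close> by (simp only: algebra_simps)
      ultimately show "h / d * u + (1 - h / d) * y \<in> {x + h / d * c..x + h}"
        unfolding atLeastAtMost_iff by linarith
    qed (use that cd atom in simp_all)
    also have "\<dots> \<le> measure N {x<..x + h}"
      using \<open>x + h / d * c > x\<close> N by (intro finite_measure_mono) auto
    also have "\<dots> = cdf N (x + h) - cdf N x"
      by (rule cdf_diff_eq [symmetric]) (use that in simp)
    finally show ?thesis .
  qed
  have "((\<lambda>y. cdf N y) \<longlongrightarrow> cdf N x) (at_right x)"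
    using cdf_is_right_cont [of x] unfolding continuous_within .
  then have "\<forall>\<^sub>F y in at_right x. cdf N y < cdf N x + e"
    using \<open>0 < e\<close> by (intro order_tendstoD) auto
  then obtain b where "x < b" "\<And>y. x < y \<Longrightarrow> y < b \<Longrightarrow> cdf N y < cdf N x + e"
    unfolding eventually_at_right_field by blast
  define h where "h = min d ((b - x) / 2)"
  have "0 < h" "h \<le> d" "h < b - x"
    using cd \<open>x < b\<close> by (auto simp: h_def min_less_iff_disj)
  then show False
    using ge [of h] \<open>\<And>y. x < y \<Longrightarrow> y < b \<Longrightarrow> cdf N y < cdf N x + e\<close> [of "x + h"] by simp
qed

lemma line_concave_atom:
  fixes N :: "real measure"
  assumes "finite_measure N" and N: "sets N = sets borel" and conc: "line_concave s N"
    and atom: "0 < measure N {x}"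
  shows "measure N (- {x}) = 0"
proof -
  interpret finite_measure N by fact
  have sp: "space N = UNIV"
    using sets_eq_imp_space_eq [OF N] by simp
  have me: "uminus \<in> borel_measurable N"
    using borel_measurable_uminus [OF measurable_ident_sets [OF N]] by simp
  interpret D: finite_measure "distr N borel uminus"
    using me by (rule finite_measure_distr)
  have vimage: "uminus -` {- x} = {x}" "uminus -` {- x<..} = {..<x}"
    by auto
  have "0 < measure (distr N borel uminus) {- x}"
    using atom measure_distr [OF me, of "{- x}"] by (simp add: sp vimage)
  then have "measure (distr N borel uminus) {- x<..} = 0"
    by (intro line_concave_atom_aux [OF D.finite_measure_axioms _ line_concave_reflect [OF N conc]]) simp_all
  then have "measure N {..<x} = 0"
    using measure_distr [OF me, of "{- x<..}"] by (simp add: sp vimage)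
  moreover have "measure N {x<..} = 0"
    using assms by (rule line_concave_atom_aux)
  moreover have "measure N ({..<x} \<union> {x<..}) \<le> measure N {..<x} + measure N {x<..}"
    by (rule measure_Un_le) (simp_all add: N)
  moreover have "measure N (- {x}) = measure N ({..<x} \<union> {x<..})"
    by (rule arg_cong [of _ _ "measure N"]) auto
  ultimately show ?thesis
    using measure_nonneg [of N "- {x}"] by linarith
qed

section \<open>The bound in a gap seen from one side\<close>

text \<open>Abel summation: by induction, a partial sum of the coefficients times the current weight
  is at most the weighted sum so far. Lowering the weight preserves this because the partial sums
  are nonnegative.\<close>

lemma sum_Abel_nonneg:
  fixes c \<Delta> :: "nat \<Rightarrow> real"
  assumes "\<And>i. i \<le> M \<Longrightarrow> 0 \<le> (\<Sum>j<i. c j)" and "\<And>i. Suc i < M \<Longrightarrow> \<Delta> (Suc i) \<le> \<Delta> i"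
    and "\<And>i. i < M \<Longrightarrow> 0 \<le> \<Delta> i"
  shows "0 \<le> (\<Sum>j<M. c j * \<Delta> j)"
proof -
  have *: "(\<Sum>j<Suc i. c j) * \<Delta> i \<le> (\<Sum>j<Suc i. c j * \<Delta> j)" if "i < M" for i
    using that
  proof (induction i)
    case (Suc i)
    have "(\<Sum>j<Suc (Suc i). c j) * \<Delta> (Suc i) = (\<Sum>j<Suc i. c j) * \<Delta> (Suc i) + c (Suc i) * \<Delta> (Suc i)"
      by (simp add: algebra_simps)
    also have "\<dots> \<le> (\<Sum>j<Suc i. c j) * \<Delta> i + c (Suc i) * \<Delta> (Suc i)"
      using Suc.prems assms(1) [of "Suc i"] assms(2) [of i] by (intro add_right_mono mult_left_mono) auto
    also have "\<dots> \<le> (\<Sum>j<Suc (Suc i). c j * \<Delta> j)"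
      using Suc by simp
    finally show ?case .
  qed simp
  then show ?thesis
  proof (cases M)
    case (Suc m)
    have "0 \<le> (\<Sum>j<Suc m. c j) * \<Delta> m"
      using assms(1) [of M] assms(3) [of m] Suc by (intro mult_nonneg_nonneg) auto
    with * [of m] show ?thesis
      unfolding Suc by simp
  qed simp
qed

text \<open>Half-open cells of a grid are disjoint, so their lengths add up. This turns a bound on
  length into a bound on the number of cells.\<close>

lemma card_cells_le_measure:
  fixes a \<tau> :: real
  assumes "finite J" "0 \<le> \<tau>" "X \<in> sets lborel" "emeasure lborel X < \<infinity>"
    "\<And>j. j \<in> J \<Longrightarrow> {a + real j * \<tau><..a + real (Suc j) * \<tau>} \<subseteq> X"
  shows "real (card J) * \<tau> \<le> measure lborel X"
proof -
  have disj: "disjoint_family_on (\<lambda>j. {a + real j * \<tau><..a + real (Suc j) * \<tau>}) J"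
    unfolding disjoint_family_on_def
  proof (intro ballI impI)
    have *: "{a + real m * \<tau><..a + real (Suc m) * \<tau>} \<inter> {a + real n * \<tau><..a + real (Suc n) * \<tau>} = {}"
      if "m < n" for m n :: nat
    proof -
      have "real (Suc m) * \<tau> \<le> real n * \<tau>"
        using that assms(2) by (intro mult_right_mono) auto
      then show ?thesis by auto
    qed
    fix m n :: nat assume "m \<noteq> n"
    then show "{a + real m * \<tau><..a + real (Suc m) * \<tau>} \<inter> {a + real n * \<tau><..a + real (Suc n) * \<tau>} = {}"
      using * [of m n] * [of n m] by (cases m n rule: linorder_cases) auto
  qed
  have "real (card J) * \<tau> = (\<Sum>j\<in>J. measure lborel {a + real j * \<tau><..a + real (Suc j) * \<tau>})"
    using assms(2) by (simp add: algebra_simps)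
  also have "\<dots> = measure lborel (\<Union>j\<in>J. {a + real j * \<tau><..a + real (Suc j) * \<tau>})"
  proof (rule measure_finite_Union [symmetric])
    show "emeasure lborel {a + real j * \<tau><..a + real (Suc j) * \<tau>} \<noteq> \<infinity>" for j
      using assms(2) by (simp add: mult_right_mono)
  qed (use assms(1) disj in auto)
  also have "\<dots> \<le> measure lborel X"
    using assms by (intro measure_mono_fmeasurable) (auto simp: fmeasurable_def)
  finally show ?thesis .
qed

text \<open>The transform \<open>lg s\<close> makes the normalised distribution function concave, and it expands
  \<open>(0, 1]\<close>, so the mass of a cell is at most the increment of a concave function.\<close>

lemma one_sided:
  fixes N :: "real measure" and a b \<delta> \<tau>\<^sub>0 :: real
  assumes "finite_measure N" and N: "sets N = sets borel" and conc: "line_concave s N" and s: "s \<le> 1"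
    and ab: "a < b" and l: "0 < measure N {..a}"
    and W: "W \<subseteq> {a<..b}" "W \<in> sets borel" and V: "V \<in> sets borel"
    and "0 < \<tau>\<^sub>0" and thick: "\<And>w x. w \<in> W \<Longrightarrow> \<bar>w - x\<bar> \<le> \<tau>\<^sub>0 \<Longrightarrow> x \<in> V"
    and \<delta>: "\<And>y. a \<le> y \<Longrightarrow> measure lborel (V \<inter> {a..y}) \<le> \<delta> * (y - a)"
  shows "measure N W \<le> \<delta> * (measure N {..b} * (- lg s (measure N {..a} / measure N {..b})))"
proof -
  interpret finite_measure N by fact
  define G where "G y = measure N {..y}" for y
  have G_mono: "G x \<le> G y" if "x \<le> y" for x y
    unfolding G_def using that N by (intro finite_measure_mono) auto
  have G_pos: "0 < G y" if "a \<le> y" for y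
    using l G_mono [OF that] by (simp add: G_def)
  have G_diff: "measure N {x<..y} = G y - G x" if "x \<le> y" for x y
  proof -
    have "{x<..y} = {..y} - {..x}" by auto
    then show ?thesis
      unfolding G_def using N that by (simp add: finite_measure_Diff)
  qed
  define m where "m = G b"
  have m: "0 < m" using G_pos ab by (simp add: m_def)
  define H where "H y = lg s (G y / m)" for y
  \<comment> \<open>Closed half-lines average to closed half-lines, so concavity passes from the
    measure to its distribution function. Midpoints suffice because the grid below is
    equidistant.\<close>
  have H_mid: "H x + H z \<le> 2 * H ((x + z) / 2)" if "a \<le> x" "a \<le> z" for x z
  proof -
    have "power_mean s (1/2) (G x) (G z) \<le> G ((x + z) / 2)"
      unfolding G_def using G_pos [OF that(1)] G_pos [OF that(2)]
      by (intro line_concaveD [OF conc]) (auto simp: G_def field_simps)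
    then have "lg s (power_mean s (1/2) (G x) (G z)) \<le> lg s (G ((x + z) / 2))"
      using G_pos that by (intro lg_mono power_mean_pos) auto
    then have "lg s (G x) + lg s (G z) \<le> 2 * lg s (G ((x + z) / 2))"
      using G_pos that by (simp add: lg_power_mean)
    then have "m powr (- s) * (lg s (G x) + lg s (G z) - 2 * lg s m)
        \<le> m powr (- s) * (2 * lg s (G ((x + z) / 2)) - 2 * lg s m)"
      using m by (intro mult_left_mono) auto
    moreover have "a \<le> (x + z) / 2"
      using that by simp
    ultimately show ?thesis
      using that G_pos m unfolding H_def by (simp add: lg_scale algebra_simps)
  qed
  \<comment> \<open>The mesh \<tau> will be at most \<open>\<tau>\<^sub>0\<close>, so that every
    cell meeting \<open>W\<close> lies entirely in \<open>V\<close>, where lengths are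
    controlled.\<close>
  obtain M :: nat where M: "(b - a) / \<tau>\<^sub>0 < real M"
    using reals_Archimedean2 by blast
  have "0 < (b - a) / \<tau>\<^sub>0" using ab \<open>0 < \<tau>\<^sub>0\<close> by simp
  with M have M0: "0 < real M" by linarith
  define \<tau> where "\<tau> = (b - a) / real M"
  have \<tau>: "0 < \<tau>" "\<tau> \<le> \<tau>\<^sub>0"
    using M M0 ab \<open>0 < \<tau>\<^sub>0\<close> by (auto simp: \<tau>_def field_simps)
  define t where "t i = a + real i * \<tau>" for i :: nat
  have t0: "t 0 = a" and tM: "t M = b"
    using M0 by (auto simp: t_def \<tau>_def)
  have t_mono: "t i \<le> t j" if "i \<le> j" for i j
    using that \<tau> by (auto simp: t_def intro: mult_right_mono)
  have t_ge: "a \<le> t i" for i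
    using t_mono [of 0 i] t0 by simp
  define \<Delta> where "\<Delta> i = H (t (Suc i)) - H (t i)" for i
  define J where "J = {j. j < M \<and> W \<inter> {t j<..t (Suc j)} \<noteq> {}}"
  have "finite J" by (simp add: J_def)
  have \<Delta>_dec: "\<Delta> (Suc i) \<le> \<Delta> i" for i
  proof -
    have "(t i + t (Suc (Suc i))) / 2 = t (Suc i)"
      by (simp add: t_def field_simps)
    with H_mid [of "t i" "t (Suc (Suc i))"] show ?thesis
      by (simp add: \<Delta>_def t_ge)
  qed
  have \<Delta>_nonneg: "0 \<le> \<Delta> i" for i
    unfolding \<Delta>_def H_def
    using G_mono [OF t_mono [of i "Suc i"]] G_pos [OF t_ge [of i]] m
    by (simp add: lg_mono divide_right_mono)
  have cover: "W \<subseteq> (\<Union>j\<in>J. {t j<..t (Suc j)})"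
  proof
    fix w assume "w \<in> W"
    then have w: "a < w" "w \<le> b" using W by auto
    define i where "i = (LEAST i. w \<le> t i)"
    have "w \<le> t i" unfolding i_def by (rule LeastI [of _ M]) (use w tM in simp)
    have "i \<noteq> 0" using \<open>w \<le> t i\<close> w t0 by (metis not_le)
    then obtain j where j: "i = Suc j" using not0_implies_Suc by blast
    have "\<not> w \<le> t j"
      using not_less_Least [of j "\<lambda>i. w \<le> t i"] j by (simp add: i_def)
    moreover have "i \<le> M"
      unfolding i_def by (rule Least_le) (use w tM in simp)
    ultimately have "j \<in> J"
      using \<open>w \<in> W\<close> \<open>w \<le> t i\<close> j by (auto simp: J_def)
    then show "w \<in> (\<Union>j\<in>J. {t j<..t (Suc j)})"
      using \<open>\<not> w \<le> t j\<close> \<open>w \<le> t i\<close> j by (intro UN_I) auto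
  qed
  have cell: "measure N {t j<..t (Suc j)} \<le> m * \<Delta> j" if "j < M" for j
  proof -
    have "G (t (Suc j)) \<le> m"
      using that t_mono [of "Suc j" M] tM by (simp add: m_def G_mono)
    then have "G (t (Suc j)) / m - G (t j) / m \<le> \<Delta> j"
      unfolding \<Delta>_def H_def using m G_pos [OF t_ge [of j]] G_mono [OF t_mono [of j "Suc j"]]
      by (intro lg_diff_ge s) (auto simp: divide_right_mono)
    then have "(G (t (Suc j)) - G (t j)) / m \<le> \<Delta> j"
      by (simp add: diff_divide_distrib)
    then show ?thesis
      using m G_diff [OF t_mono [of j "Suc j"]] by (simp add: field_simps)
  qed
  \<comment> \<open>Among the first i cells at most \<delta> * i meet \<open>W\<close>, for every i
    and not only for the whole interval: these are the partial sums that Abel summation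
    needs.\<close>
  have count: "real (card (J \<inter> {..<i})) \<le> \<delta> * real i" if "i \<le> M" for i
  proof -
    have "real (card (J \<inter> {..<i})) * \<tau> \<le> measure lborel (V \<inter> {a..t i})"
    proof (rule card_cells_le_measure)
      fix j assume j: "j \<in> J \<inter> {..<i}"
      then obtain w where w: "w \<in> W" "t j < w" "w \<le> t (Suc j)"
        by (auto simp: J_def)
      have "t (Suc j) = t j + \<tau>" by (simp add: t_def algebra_simps)
      moreover have "t (Suc j) \<le> t i" using j by (intro t_mono) auto
      ultimately show "{a + real j * \<tau><..a + real (Suc j) * \<tau>} \<subseteq> V \<inter> {a..t i}"
        using w t_ge [of j] \<tau> thick [OF w(1)] unfolding t_def [symmetric]
        by (auto simp: abs_le_iff)
    next
      have "emeasure lborel (V \<inter> {a..t i}) \<le> emeasure lborel {a..t i}"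
        by (rule emeasure_mono) auto
      then show "emeasure lborel (V \<inter> {a..t i}) < \<infinity>"
        using t_ge [of i] by (simp add: le_less_trans)
    qed (use \<tau> V in auto)
    also have "\<dots> \<le> \<delta> * real i * \<tau>"
      using \<delta> [OF t_ge [of i]] by (simp add: t_def)
    finally show ?thesis using \<tau> by simp
  qed
  \<comment> \<open>The increments of \<open>H\<close> decrease, so the cells in \<open>J\<close>,
    which never run ahead of the rate \<delta>, carry at most the fraction \<delta> of the total
    increment.\<close>
  have "0 \<le> (\<Sum>j<M. (\<delta> - of_bool (j \<in> J)) * \<Delta> j)"
  proof (rule sum_Abel_nonneg)
    fix i assume "i \<le> M"
    have "(\<Sum>j<i. of_bool (j \<in> J)) = real (card (J \<inter> {..<i}))"
      by (simp add: of_bool_def sum.If_cases Int_commute)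
    with count [OF \<open>i \<le> M\<close>] show "0 \<le> (\<Sum>j<i. \<delta> - of_bool (j \<in> J))"
      by (simp add: sum_subtractf mult.commute)
  qed (use \<Delta>_dec \<Delta>_nonneg in auto)
  moreover have "(\<Sum>j<M. of_bool (j \<in> J) * \<Delta> j) = (\<Sum>j\<in>J. \<Delta> j)"
    by (rule sum.mono_neutral_cong_right) (auto simp: J_def)
  moreover have "(\<Sum>j<M. \<Delta> j) = H b - H a"
    unfolding \<Delta>_def by (subst sum_lessThan_telescope) (simp add: t0 tM)
  ultimately have sumJ: "(\<Sum>j\<in>J. \<Delta> j) \<le> \<delta> * (H b - H a)"
    by (simp add: left_diff_distrib sum_subtractf sum_distrib_left [symmetric])
  have "measure N W \<le> measure N (\<Union>j\<in>J. {t j<..t (Suc j)})"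
    using cover N by (intro finite_measure_mono) auto
  also have "\<dots> \<le> (\<Sum>j\<in>J. measure N {t j<..t (Suc j)})"
    using \<open>finite J\<close> N by (intro finite_measure_subadditive_finite) (simp_all add: image_subset_iff)
  also have "\<dots> \<le> (\<Sum>j\<in>J. m * \<Delta> j)"
    by (intro sum_mono cell) (auto simp: J_def)
  also have "\<dots> \<le> m * (\<delta> * (H b - H a))"
    using sumJ m by (simp add: sum_distrib_left [symmetric])
  also have "H b = 0" using m by (simp add: H_def m_def)
  finally show ?thesis
    by (simp add: H_def m_def G_def algebra_simps)
qed

text \<open>Obtained from \<open>one_sided\<close> by reflecting the measure, which also exchanges
  the two kinds of half-open intervals.\<close>

lemma one_sided_right:
  fixes N :: "real measure" and a b \<delta> \<tau>\<^sub>0 :: real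
  assumes "finite_measure N" and N: "sets N = sets borel" and conc: "line_concave s N" and s: "s \<le> 1"
    and ab: "a < b" and r: "0 < measure N {b..}"
    and W: "W \<subseteq> {a..<b}" "W \<in> sets borel" and V: "V \<in> sets borel"
    and "0 < \<tau>\<^sub>0" and thick: "\<And>w x. w \<in> W \<Longrightarrow> \<bar>w - x\<bar> \<le> \<tau>\<^sub>0 \<Longrightarrow> x \<in> V"
    and \<delta>: "\<And>y. y \<le> b \<Longrightarrow> measure lborel (V \<inter> {y..b}) \<le> \<delta> * (b - y)"
  shows "measure N W \<le> \<delta> * (measure N {a..} * (- lg s (measure N {b..} / measure N {a..})))"
proof -
  interpret finite_measure N by fact
  have me: "uminus \<in> borel_measurable N"
    using borel_measurable_uminus [OF measurable_ident_sets [OF N]] by simp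
  have sp: "space N = UNIV"
    using sets_eq_imp_space_eq [OF N] by simp
  define D where "D = distr N borel uminus"
  have D: "measure D X = measure N (uminus -` X)" if "X \<in> sets borel" for X
    unfolding D_def using measure_distr [OF me that] by (simp add: sp)
  have vim: "uminus -` {..- x} = {x..}" for x :: real by auto
  have vs: "uminus -` X \<in> sets borel" if "X \<in> sets borel" for X :: "real set"
  proof -
    have "uminus \<in> borel_measurable (borel :: real measure)" by simp
    from measurable_sets [OF this that] show ?thesis by simp
  qed
  have L: "measure lborel (uminus -` X) = measure lborel X" if "X \<in> sets borel" for X :: "real set"
  proof -
    have "measure (distr lborel borel uminus) X = measure lborel (uminus -` X \<inter> space lborel)"
      by (rule measure_distr) (use that in auto)
    then show ?thesis by (simp add: lborel_distr_uminus)
  qed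
  have "measure D (uminus -` W) \<le> \<delta> * (measure D {..- a} * (- lg s (measure D {..- b} / measure D {..- a})))"
  proof (rule one_sided [where V = "uminus -` V"])
    show "finite_measure D"
      unfolding D_def using me by (rule finite_measure_distr)
    show "sets D = sets borel" by (simp add: D_def)
    show "line_concave s D"
      unfolding D_def by (rule line_concave_reflect [OF N conc])
    show "0 < measure D {..- b}"
      using r by (simp add: D vim)
    show "uminus -` W \<subseteq> {- b<..- a}"
      using W(1) by auto
    show "x \<in> uminus -` V" if "w \<in> uminus -` W" "\<bar>w - x\<bar> \<le> \<tau>\<^sub>0" for w x
      using thick [of "- w" "- x"] that by (simp add: abs_minus_commute)
    show "measure lborel (uminus -` V \<inter> {- b..y}) \<le> \<delta> * (y - - b)" if "- b \<le> y" for y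
    proof -
      have eq: "uminus -` V \<inter> {- b..y} = uminus -` (V \<inter> {- y..b})" by auto
      have "measure lborel (uminus -` V \<inter> {- b..y}) = measure lborel (V \<inter> {- y..b})"
        unfolding eq using V by (intro L) auto
      then show ?thesis
        using \<delta> [of "- y"] that by (simp add: algebra_simps)
    qed
  qed (use ab s W V \<open>0 < \<tau>\<^sub>0\<close> vs in auto)
  moreover have "uminus -` (uminus -` W) = W" by auto
  ultimately show ?thesis
    using W by (simp add: D vim vs)
qed

section \<open>Gaps of a closed set and the sum over them\<close>

text \<open>As m \<le> 1, both the factor m and the replacement of l / m by l only help. The result
  no longer mentions m, the mass up to an auxiliary cut-off point, when only one side of a gap
  carries outer mass.\<close>

lemma neg_lg_mass_le:
  assumes "0 < l" "l \<le> m" "m \<le> 1" "0 \<le> \<delta>"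
  shows "\<delta> * (m * (- lg s (l / m))) \<le> \<delta> * (- lg s l)"
proof -
  have "l / m \<le> 1" "0 < l / m" "l \<le> l / m"
    using assms by (auto simp: field_simps mult_left_le)
  then have "0 \<le> - lg s (l / m)" "- lg s (l / m) \<le> - lg s l"
    using lg_mono [of "l / m" 1 s] lg_mono [of l "l / m" s] assms by auto
  then have "m * (- lg s (l / m)) \<le> 1 * (- lg s l)"
    using assms by (intro mult_mono) auto
  then show ?thesis
    using assms by (simp add: mult_left_mono)
qed

text \<open>The left end of the gap is the largest point of \<open>K\<close> below \<open>w\<close>.
  Closedness puts it into \<open>K\<close>, so the length condition is available for segments
  starting there. Treating the two ends separately yields the four shapes of a gap from two
  dichotomies.\<close>

lemma connected_component_set_left:
  fixes K :: "real set"
  assumes "closed K" "w \<notin> K"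
  shows "{..w} \<subseteq> connected_component_set (- K) w \<or>
    (\<exists>a\<in>K. a < w \<and> {a<..w} \<subseteq> connected_component_set (- K) w \<and> connected_component_set (- K) w \<subseteq> {a<..})"
proof (cases "K \<inter> {..w} = {}")
  case True
  then have "{..w} \<subseteq> connected_component_set (- K) w"
    by (intro connected_component_maximal) auto
  then show ?thesis ..
next
  case False
  define a where "a = Sup (K \<inter> {..w})"
  have "bdd_above (K \<inter> {..w})" by (auto intro: bdd_aboveI)
  then have a: "a \<in> K \<inter> {..w}"
    unfolding a_def using False assms by (intro closed_contains_Sup) auto
  then have "a < w"
    using assms by (cases "a = w") auto
  have "{a<..w} \<inter> K = {}"
  proof -
    have "x \<le> a" if "x \<in> K" "x \<le> w" for x
      unfolding a_def using that \<open>bdd_above _\<close> by (intro cSup_upper) auto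
    then show ?thesis by force
  qed
  then have "{a<..w} \<subseteq> connected_component_set (- K) w"
    using \<open>a < w\<close> by (intro connected_component_maximal) auto
  moreover have "connected_component_set (- K) w \<subseteq> {a<..}"
  proof
    fix x assume x: "x \<in> connected_component_set (- K) w"
    have w: "w \<in> connected_component_set (- K) w"
      using assms by (simp add: connected_component_refl)
    show "x \<in> {a<..}"
    proof (rule ccontr)
      assume "x \<notin> {a<..}"
      then have "a \<in> connected_component_set (- K) w"
        using \<open>a < w\<close> by (intro subsetD [OF connected_contains_Icc [OF connected_connected_component x w]]) auto
      then show False
        using connected_component_subset [of "- K" w] a by auto
    qed
  qed
  ultimately show ?thesis
    using a \<open>a < w\<close> by blast
qed

lemma connected_component_set_right:
  fixes K :: "real set"
  assumes "closed K" "w \<notin> K"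
  shows "{w..} \<subseteq> connected_component_set (- K) w \<or>
    (\<exists>b\<in>K. w < b \<and> {w..<b} \<subseteq> connected_component_set (- K) w \<and> connected_component_set (- K) w \<subseteq> {..<b})"
proof (cases "K \<inter> {w..} = {}")
  case True
  then have "{w..} \<subseteq> connected_component_set (- K) w"
    by (intro connected_component_maximal) auto
  then show ?thesis ..
next
  case False
  define b where "b = Inf (K \<inter> {w..})"
  have "bdd_below (K \<inter> {w..})" by (auto intro: bdd_belowI)
  then have b: "b \<in> K \<inter> {w..}"
    unfolding b_def using False assms by (intro closed_contains_Inf) auto
  then have "w < b"
    using assms by (cases "b = w") auto
  have "{w..<b} \<inter> K = {}"
  proof -
    have "b \<le> x" if "x \<in> K" "w \<le> x" for x
      unfolding b_def using that \<open>bdd_below _\<close> by (intro cInf_lower) auto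
    then show ?thesis by force
  qed
  then have "{w..<b} \<subseteq> connected_component_set (- K) w"
    using \<open>w < b\<close> by (intro connected_component_maximal) auto
  moreover have "connected_component_set (- K) w \<subseteq> {..<b}"
  proof
    fix x assume x: "x \<in> connected_component_set (- K) w"
    have w: "w \<in> connected_component_set (- K) w"
      using assms by (simp add: connected_component_refl)
    show "x \<in> {..<b}"
    proof (rule ccontr)
      assume "x \<notin> {..<b}"
      then have "b \<in> connected_component_set (- K) w"
        using \<open>w < b\<close> by (intro subsetD [OF connected_contains_Icc [OF connected_connected_component w x]]) auto
      then show False
        using connected_component_subset [of "- K" w] b by auto
    qed
  qed
  ultimately show ?thesis
    using b \<open>w < b\<close> by blast
qed

text \<open>A gap with mass on both sides is split so that both parts contain the same proportion of
  the mass outside the gap; then the two one-sided bounds add up exactly.\<close>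

lemma gap_bound:
  fixes N :: "real measure" and \<delta> \<tau>\<^sub>0 R :: real
  assumes "prob_space N" and N: "sets N = sets borel" and conc: "line_concave s N" and s: "s \<le> 1"
    and atomless: "\<And>x. measure N {x} = 0"
    and K: "closed K" "0 < measure N K" and w: "w \<notin> K"
    and W: "W \<subseteq> connected_component_set (- K) w" "W \<subseteq> {- R..R}" "W \<in> sets borel" and V: "V \<in> sets borel"
    and "0 < \<tau>\<^sub>0" and thick: "\<And>w x. w \<in> W \<Longrightarrow> \<bar>w - x\<bar> \<le> \<tau>\<^sub>0 \<Longrightarrow> x \<in> V" and "0 \<le> \<delta>"
    and \<delta>: "\<And>a y. a \<in> K \<Longrightarrow> measure lborel (V \<inter> closed_segment a y) \<le> \<delta> * \<bar>y - a\<bar>"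
  shows "measure N W \<le> \<delta> * (- lg s (1 - measure N (connected_component_set (- K) w)))"
proof -
  interpret prob_space N by fact
  interpret finite_borel_measure N
    by unfold_locales (rule N)
  have sp: "space N = UNIV"
    using sets_eq_imp_space_eq [OF N] by simp
  define I where "I = connected_component_set (- K) w"
  have "open I"
    unfolding I_def using K by (intro open_connected_component) auto
  then have IN: "I \<in> sets N" by (simp add: N)
  have "K \<subseteq> - I"
    unfolding I_def using connected_component_subset [of "- K" w] by auto
  then have "measure N K \<le> measure N (- I)"
    using IN by (intro finite_measure_mono) (auto simp: N)
  also have compl: "measure N (- I) = 1 - measure N I"
    using prob_compl [OF IN] by (simp add: sp Compl_eq_Diff_UNIV)
  finally have I_lt: "measure N I < 1" using K by simp
  have left: "measure N X \<le> \<delta> * (measure N {..y} * (- lg s (measure N {..a} / measure N {..y})))"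
    if "a \<in> K" "a < y" "0 < measure N {..a}" "X \<subseteq> W" "X \<subseteq> {a<..y}" "X \<in> sets borel" for a y X
  proof (rule one_sided [OF finite_measure_axioms N conc s that(2,3,5,6) V \<open>0 < \<tau>\<^sub>0\<close>])
    show "x \<in> V" if "w \<in> X" "\<bar>w - x\<bar> \<le> \<tau>\<^sub>0" for w x
      using thick that \<open>X \<subseteq> W\<close> by blast
    show "measure lborel (V \<inter> {a..y}) \<le> \<delta> * (y - a)" if "a \<le> y" for y
      using \<delta> [OF \<open>a \<in> K\<close>, of y] that by (simp add: closed_segment_eq_real_ivl)
  qed
  have right: "measure N X \<le> \<delta> * (measure N {y..} * (- lg s (measure N {b..} / measure N {y..})))"
    if "b \<in> K" "y < b" "0 < measure N {b..}" "X \<subseteq> W" "X \<subseteq> {y..<b}" "X \<in> sets borel" for b y X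
  proof (rule one_sided_right [OF finite_measure_axioms N conc s that(2,3,5,6) V \<open>0 < \<tau>\<^sub>0\<close>])
    show "x \<in> V" if "w \<in> X" "\<bar>w - x\<bar> \<le> \<tau>\<^sub>0" for w x
      using thick that \<open>X \<subseteq> W\<close> by blast
    show "measure lborel (V \<inter> {y..b}) \<le> \<delta> * (b - y)" if "y \<le> b" for y
      using \<delta> [OF \<open>b \<in> K\<close>, of y] that by (simp add: closed_segment_eq_real_ivl1 closed_segment_commute [of b y])
  qed
  have left': "measure N W \<le> \<delta> * (- lg s (measure N {..a}))"
    if "a \<in> K" "0 < measure N {..a}" "W \<subseteq> {a<..}" for a
  proof -
    \<comment> \<open>\<open>R\<close> covers all of \<open>W\<close> from the right;
      \<open>a + 1\<close> keeps y to the right of a when \<open>R \<le> a\<close>.\<close>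
    define y where "y = max (a + 1) R"
    have "{a<..} \<inter> {- R..R} \<subseteq> {a<..y}" by (auto simp: y_def)
    then have "W \<subseteq> {a<..y}" using that(3) W(2) by blast
    have "measure N W \<le> \<delta> * (measure N {..y} * (- lg s (measure N {..a} / measure N {..y})))"
      using W(3) that \<open>W \<subseteq> {a<..y}\<close> by (intro left) (auto simp: y_def)
    also have "\<dots> \<le> \<delta> * (- lg s (measure N {..a}))"
      using that \<open>0 \<le> \<delta>\<close> by (intro neg_lg_mass_le finite_measure_mono) (auto simp: y_def N)
    finally show ?thesis .
  qed
  have right': "measure N W \<le> \<delta> * (- lg s (measure N {b..}))"
    if "b \<in> K" "0 < measure N {b..}" "W \<subseteq> {..<b}" for b
  proof -
    define y where "y = min (b - 1) (- R)"
    have "{..<b} \<inter> {- R..R} \<subseteq> {y..<b}" by (auto simp: y_def)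
    then have "W \<subseteq> {y..<b}" using that(3) W(2) by blast
    have "measure N W \<le> \<delta> * (measure N {y..} * (- lg s (measure N {b..} / measure N {y..})))"
      using W(3) that \<open>W \<subseteq> {y..<b}\<close> by (intro right) (auto simp: y_def)
    also have "\<dots> \<le> \<delta> * (- lg s (measure N {b..}))"
      using that \<open>0 \<le> \<delta>\<close> by (intro neg_lg_mass_le finite_measure_mono) (auto simp: y_def N)
    finally show ?thesis .
  qed
  note L = connected_component_set_left [OF K(1) w, folded I_def]
    and R = connected_component_set_right [OF K(1) w, folded I_def]
  have WI: "W \<subseteq> I" using W by (simp add: I_def)
  show ?thesis
    unfolding I_def [symmetric]
  proof (cases "measure N I = 0")
    \<comment> \<open>A gap without mass is set apart, since the splitting point below is strictly
      inside the gap only if l + r < 1.\<close>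
    case True
    then have "measure N W \<le> 0"
      using finite_measure_mono [OF WI IN] by simp
    then show "measure N W \<le> \<delta> * (- lg s (1 - measure N I))"
      using True by simp
  next
    case False
    then have I_pos: "0 < measure N I"
      by (simp add: zero_less_measure_iff)
    show "measure N W \<le> \<delta> * (- lg s (1 - measure N I))"
      using L
    proof (elim disjE bexE conjE)
      assume Lw: "{..w} \<subseteq> I"
      show ?thesis
        using R
      proof (elim disjE bexE conjE)
        assume "{w..} \<subseteq> I"
        with Lw have "I = UNIV" by (auto intro: set_eqI) (meson atMost_iff atLeast_iff linear subsetD)
        then show ?thesis using I_lt prob_space by (simp add: sp)
      next
        fix b assume b: "b \<in> K" "w < b" "{w..<b} \<subseteq> I" "I \<subseteq> {..<b}"
        have "{..<b} \<subseteq> {..w} \<union> {w..<b}" by auto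
        then have "I = {..<b}" using Lw b by blast
        then have "- I = {b..}" by auto
        then have "measure N {b..} = 1 - measure N I" using compl by simp
        then show ?thesis
          using right' [OF b(1)] I_lt b(4) WI by auto
      qed
    next
      fix a assume a: "a \<in> K" "a < w" "{a<..w} \<subseteq> I" "I \<subseteq> {a<..}"
      show ?thesis
        using R
      proof (elim disjE bexE conjE)
        assume "{w..} \<subseteq> I"
        moreover have "{a<..} \<subseteq> {a<..w} \<union> {w..}" by auto
        ultimately have "I = {a<..}" using a by blast
        then have "- I = {..a}" by auto
        then have "measure N {..a} = 1 - measure N I" using compl by simp
        then show ?thesis
          using left' [OF a(1)] I_lt a(4) WI by auto
      next
        fix b assume b: "b \<in> K" "w < b" "{w..<b} \<subseteq> I" "I \<subseteq> {..<b}"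
        define l r where "l = measure N {..a}" and "r = measure N {b..}"
        have "{a<..<b} \<subseteq> {a<..w} \<union> {w..<b}" "{a<..<b} = {a<..} \<inter> {..<b}" by auto
        then have I: "I = {a<..<b}" using a b by blast
        then have "- I = {..a} \<union> {b..}" by auto
        moreover have "{..a} \<inter> {b..} = {}" using a b by auto
        ultimately have lr: "l + r = 1 - measure N I"
          using compl finite_measure_Union [of "{..a}" "{b..}"] by (simp add: l_def r_def N)
        have "0 \<le> l" "0 \<le> r" by (simp_all add: l_def r_def)
        consider "r = 0" | "l = 0" | "0 < l" "0 < r" using \<open>0 \<le> l\<close> \<open>0 \<le> r\<close> by linarith
        then show ?thesis
        proof cases
          case 1
          then show ?thesis using left' [OF a(1)] lr I_lt a(4) WI by (auto simp: l_def)
        next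
          case 2
          then show ?thesis using right' [OF b(1)] lr I_lt b(4) WI by (auto simp: r_def)
        next
          case 3
          have "measure N {..<x} = measure N {..x}" for x
          proof -
            have "{..x} = {..<x} \<union> {x}" by auto
            then show ?thesis
              using finite_measure_Union [of "{..<x}" "{x}"] atomless [of x] by (simp add: N)
          qed
          then have tail: "measure N {x..} = 1 - measure N {..x}" for x
            using prob_compl [of "{..<x}"] by (simp add: sp N Compl_eq_Diff_UNIV [symmetric])
          have lr1: "l + r < 1" using lr I_pos by simp
          \<comment> \<open>With this value the half-line up to y has mass l / (l + r), of which l
            lies outside the gap, and the half-line from y on has mass r / (l + r), of which r lies
            outside. Both proportions equal l + r, and the two masses add up to 1.\<close>
          have "\<exists>y\<ge>a. y \<le> b \<and> cdf N y = l / (l + r)"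
          proof (rule IVT)
            show "cdf N a \<le> l / (l + r)"
              using 3 lr1 mult_left_mono [of "l + r" 1 l]
              by (simp add: cdf_def l_def [symmetric] pos_le_divide_eq)
            have "r * (l + r) \<le> r" using 3 lr1 by simp
            then have "l \<le> (1 - r) * (l + r)" by (simp add: algebra_simps)
            moreover have "cdf N b = 1 - r"
              using tail [of b] by (simp add: cdf_def r_def)
            ultimately show "l / (l + r) \<le> cdf N b"
              using 3 by (simp add: pos_divide_le_eq)
            show "a \<le> b" using a b by simp
            show "\<forall>x. a \<le> x \<and> x \<le> b \<longrightarrow> isCont (cdf N) x"
              by (simp add: isCont_cdf atomless)
          qed
          then obtain y where y: "a \<le> y" "y \<le> b" "measure N {..y} = l / (l + r)"
            by (auto simp: cdf_def)
          have y': "measure N {y..} = r / (l + r)"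
            using 3 by (simp add: tail y(3) field_simps)
          have "l \<noteq> l / (l + r)" "r \<noteq> r / (l + r)"
            using 3 lr1 by (auto simp: nonzero_eq_divide_eq)
          then have "a \<noteq> y" "y \<noteq> b"
            using y(3) y' by (auto simp: l_def r_def)
          then have ay: "a < y" "y < b" using y by auto
          have "measure N W \<le> measure N (W \<inter> {a<..y}) + measure N (W \<inter> {y..<b})"
          proof -
            have "W = (W \<inter> {a<..y}) \<union> (W \<inter> {y..<b})" using WI I by auto
            then show ?thesis
              using measure_Un_le [of "W \<inter> {a<..y}" N "W \<inter> {y..<b}"] W(3) by (simp add: N)
          qed
          also have "\<dots> \<le> \<delta> * (l / (l + r) * (- lg s (l + r))) + \<delta> * (r / (l + r) * (- lg s (l + r)))"
          proof (rule add_mono)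
            have "l / (l / (l + r)) = l + r" "r / (r / (l + r)) = l + r" using 3 by auto
            with left [OF a(1) ay(1), of "W \<inter> {a<..y}"] right [OF b(1) ay(2), of "W \<inter> {y..<b}"] W(3)
            show "measure N (W \<inter> {a<..y}) \<le> \<delta> * (l / (l + r) * (- lg s (l + r)))"
              "measure N (W \<inter> {y..<b}) \<le> \<delta> * (r / (l + r) * (- lg s (l + r)))"
              using 3 by (simp_all add: y(3) y' l_def [symmetric] r_def [symmetric])
          qed
          also have "\<dots> = \<delta> * ((l / (l + r) + r / (l + r)) * (- lg s (l + r)))"
            by (simp only: distrib_left distrib_right)
          also have "l / (l + r) + r / (l + r) = 1"
            using 3 by (simp add: add_divide_distrib [symmetric])
          finally show ?thesis by (simp add: lr)
        qed
      qed
    qed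
  qed
qed

lemma lg_sum:
  assumes "s \<le> 1" "finite J" "\<And>j. j \<in> J \<Longrightarrow> 0 \<le> x j" "(\<Sum>j\<in>J. x j) < 1"
  shows "lg s (1 - (\<Sum>j\<in>J. x j)) \<le> (\<Sum>j\<in>J. lg s (1 - x j))"
  using assms(2-)
proof (induction J rule: finite_induct)
  case (insert j J)
  have "0 \<le> (\<Sum>j\<in>J. x j)" using insert by (intro sum_nonneg) auto
  then have "lg s (1 - (x j + (\<Sum>j\<in>J. x j))) \<le> lg s (1 - x j) + lg s (1 - (\<Sum>j\<in>J. x j))"
    using insert by (intro lg_subadd assms(1)) auto
  moreover have "lg s (1 - (\<Sum>j\<in>J. x j)) \<le> (\<Sum>j\<in>J. lg s (1 - x j))"
  proof (rule insert.IH)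
    have "x j + (\<Sum>j\<in>J. x j) < 1" "0 \<le> x j" using insert by auto
    then show "(\<Sum>j\<in>J. x j) < 1" by linarith
  qed (use insert in auto)
  ultimately show ?case
    using insert by simp
qed simp

text \<open>The one-dimensional inequality. The components of the complement of \<open>K\<close>
  form an open cover of the compact set \<open>W\<close>, so finitely many gaps matter and their
  bounds can be summed. \<open>V\<close> and \<open>\<tau>\<^sub>0\<close> provide the margin around
  \<open>W\<close> that the grid argument consumes.\<close>

lemma line_bound:
  fixes N :: "real measure" and \<delta> \<tau>\<^sub>0 :: real
  assumes "prob_space N" and N: "sets N = sets borel" and conc: "line_concave s N" and s: "s \<le> 1"
    and K: "closed K" "0 < measure N K"
    and W: "compact W" "W \<inter> K = {}" and V: "V \<in> sets borel"
    and "0 < \<tau>\<^sub>0" and thick: "\<And>w x. w \<in> W \<Longrightarrow> \<bar>w - x\<bar> \<le> \<tau>\<^sub>0 \<Longrightarrow> x \<in> V" and "0 \<le> \<delta>"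
    and \<delta>: "\<And>a y. a \<in> K \<Longrightarrow> measure lborel (V \<inter> closed_segment a y) \<le> \<delta> * \<bar>y - a\<bar>"
  shows "measure N W \<le> \<delta> * (- lg s (measure N K))"
proof -
  interpret prob_space N by fact
  have sp: "space N = UNIV"
    using sets_eq_imp_space_eq [OF N] by simp
  have "lg s (measure N K) \<le> lg s 1"
    using K by (intro lg_mono) auto
  then have rhs: "0 \<le> \<delta> * (- lg s (measure N K))"
    using \<open>0 \<le> \<delta>\<close> by (intro mult_nonneg_nonneg) simp_all
  show ?thesis
  proof (cases "\<exists>x. 0 < measure N {x}")
    \<comment> \<open>An atom carries the whole measure. Since \<open>K\<close> has positive mass
      the atom lies in \<open>K\<close>, and \<open>W\<close> is null.\<close>
    case True
    then obtain x where x: "0 < measure N {x}" by blast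
    then have 0: "measure N (- {x}) = 0"
      by (rule line_concave_atom [OF finite_measure_axioms N conc])
    have "x \<in> K"
    proof (rule ccontr)
      assume "x \<notin> K"
      then have "measure N K \<le> measure N (- {x})"
        by (intro finite_measure_mono) (auto simp: N)
      then show False using 0 K by simp
    qed
    then have "measure N W \<le> measure N (- {x})"
      using W by (intro finite_measure_mono) (auto simp: N)
    with 0 rhs show ?thesis by simp
  next
    case False
    then have atomless: "measure N {x} = 0" for x
      using measure_nonneg [of N "{x}"] by (metis order_le_less)
    obtain R where "\<forall>x\<in>W. \<bar>x\<bar> \<le> R"
      using compact_imp_bounded [OF W(1)] by (auto simp: bounded_real)
    then have R: "W \<subseteq> {- R..R}" by (auto simp: abs_le_iff)
    have comp: "open C" if "C \<in> components (- K)" for C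
      using that K by (auto intro: open_components)
    have "W \<subseteq> \<Union> (components (- K))"
      using W by (auto simp: Union_components [symmetric])
    then obtain \<C> where \<C>: "\<C> \<subseteq> components (- K)" "finite \<C>" "W \<subseteq> \<Union>\<C>"
      using compactE [OF W(1)] comp by metis
    have \<C>N: "C \<in> sets N" if "C \<in> \<C>" for C
      using that comp \<C>(1) by (auto simp: N)
    have disj: "disjoint_family_on (\<lambda>C. C) \<C>"
      unfolding disjoint_family_on_def using \<C>(1) components_nonoverlap by blast
    have "(\<Sum>C\<in>\<C>. measure N C) = measure N (\<Union>C\<in>\<C>. C)"
      using \<C>N \<C>(2) disj by (intro finite_measure_finite_Union [symmetric]) auto
    also have "\<dots> \<le> measure N (- K)"
    proof (rule finite_measure_mono)
      show "(\<Union>C\<in>\<C>. C) \<subseteq> - K"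
        using \<C>(1) in_components_subset by blast
    qed (use K in \<open>simp add: N\<close>)
    also have "\<dots> = 1 - measure N K"
      using prob_compl [of K] K by (simp add: sp N Compl_eq_Diff_UNIV)
    finally have sum_le: "(\<Sum>C\<in>\<C>. measure N C) \<le> 1 - measure N K" .
    have "measure N W \<le> measure N (\<Union>C\<in>\<C>. W \<inter> C)"
      using \<C>(3) W(1) \<C>(2) \<C>N
      by (intro finite_measure_mono sets.finite_UN) (auto simp: N compact_imp_closed intro!: sets.Int)
    also have "\<dots> \<le> (\<Sum>C\<in>\<C>. measure N (W \<inter> C))"
      using \<C>(2) \<C>N W(1)
      by (intro finite_measure_subadditive_finite) (auto simp: N compact_imp_closed image_subset_iff intro!: sets.Int)
    also have "\<dots> \<le> (\<Sum>C\<in>\<C>. \<delta> * (- lg s (1 - measure N C)))"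
    proof (rule sum_mono)
      fix C assume C: "C \<in> \<C>"
      then obtain w where w: "w \<notin> K" "C = connected_component_set (- K) w"
        using \<C>(1) by (auto simp: components_def)
      show "measure N (W \<inter> C) \<le> \<delta> * (- lg s (1 - measure N C))"
        unfolding w(2)
      proof (rule gap_bound [OF assms(1) N conc s atomless K w(1) _ _ _ V \<open>0 < \<tau>\<^sub>0\<close> _ \<open>0 \<le> \<delta>\<close> \<delta>])
        show "W \<inter> connected_component_set (- K) w \<subseteq> {- R..R}" using R by auto
        show "W \<inter> connected_component_set (- K) w \<in> sets borel"
          using \<C>N [OF C] W(1) w(2) by (auto simp: N compact_imp_closed)
      qed (use thick in auto)
    qed
    also have "\<dots> = \<delta> * (- (\<Sum>C\<in>\<C>. lg s (1 - measure N C)))"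
      by (simp add: sum_distrib_left sum_negf)
    \<comment> \<open>The gaps avoid \<open>K\<close>, so their total mass is at most that of its
      complement; superadditivity combines the separate terms into one.\<close>
    also have "\<dots> \<le> \<delta> * (- lg s (measure N K))"
    proof (rule mult_left_mono [OF _ \<open>0 \<le> \<delta>\<close>])
      have "lg s (measure N K) \<le> lg s (1 - (\<Sum>C\<in>\<C>. measure N C))"
        using sum_le K by (intro lg_mono) auto
      also have "\<dots> \<le> (\<Sum>C\<in>\<C>. lg s (1 - measure N C))"
        using sum_le K \<C>(2) by (intro lg_sum s) auto
      finally show "- (\<Sum>C\<in>\<C>. lg s (1 - measure N C)) \<le> - lg s (measure N K)" by simp
    qed
    finally show ?thesis .
  qed
qed

section \<open>Localization to needles\<close>

lemma s_concaveD:
  assumes "s_concave s M" "compact A" "compact B" "0 < measure M A" "0 < measure M B" "0 \<le> \<alpha>" "\<alpha> \<le> 1"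
  shows "power_mean s \<alpha> (measure M A) (measure M B)
    \<le> measure M {\<alpha> *\<^sub>R x + (1 - \<alpha>) *\<^sub>R y |x y. x \<in> A \<and> y \<in> B}"
  using assms(1) [unfolded s_concave_def, rule_format, of A B \<alpha>] assms(2-) by simp

text \<open>Preimages of closed sets under the affine map \<open>g\<close> meet \<open>C\<close> in
  compact sets, to which concavity of \<open>M\<close> applies, and convexity keeps their
  combinations in \<open>C\<close>. Homogeneity of power means takes care of the normalisation. The
  map is later a normal vector, to detect charged hyperplanes, or the coordinate along a
  needle.\<close>

lemma pushforward_line_concave:
  fixes M :: "(real ^ 'n) measure" and g :: "real ^ 'n \<Rightarrow> real"
  assumes "prob_space M" and M: "sets M = sets borel" and conc: "s_concave s M"
    and C: "compact C" "convex C" "0 < measure M C"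
    and g: "continuous_on UNIV g" "\<And>\<alpha> x y. g (\<alpha> *\<^sub>R x + (1 - \<alpha>) *\<^sub>R y) = \<alpha> * g x + (1 - \<alpha>) * g y"
  defines "N \<equiv> distr (uniform_measure M C) borel g"
  shows "prob_space N" "sets N = sets borel" "line_concave s N"
    and "\<And>X. X \<in> sets borel \<Longrightarrow> measure N X = measure M (C \<inter> g -` X) / measure M C"
proof -
  interpret prob_space M by fact
  have sp: "space M = UNIV"
    using sets_eq_imp_space_eq [OF M] by simp
  have Cb: "C \<in> sets M" using C(1) by (simp add: M compact_imp_closed)
  have em: "emeasure M C \<noteq> 0" "emeasure M C \<noteq> \<infinity>"
    using C(3) by (auto simp: measure_def)
  interpret U: prob_space "uniform_measure M C"
    using em by (rule prob_space_uniform_measure)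
  have gb: "g \<in> borel_measurable borel"
    using g(1) by (rule borel_measurable_continuous_onI)
  have gm: "g \<in> borel_measurable (uniform_measure M C)"
    using gb by (simp add: measurable_def sp M space_borel)
  show "prob_space N"
    unfolding N_def using gm by (rule U.prob_space_distr)
  show "sets N = sets borel" by (simp add: N_def)
  show N: "measure N X = measure M (C \<inter> g -` X) / measure M C" if "X \<in> sets borel" for X
  proof -
    have "g -` X \<in> sets M"
      using measurable_sets [OF gb that] by (simp add: M)
    then show ?thesis
      unfolding N_def using measure_distr [OF gm that] em
      by (simp add: sp measure_uniform_measure)
  qed
  show "line_concave s N"
    unfolding line_concave_def
  proof (intro allI impI)
    fix A B T :: "real set" and \<alpha> :: real
    assume *: "closed A" "closed B" "closed T" "0 < measure N A" "0 < measure N B" "0 \<le> \<alpha>" "\<alpha> \<le> 1"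
      "\<forall>x\<in>A. \<forall>y\<in>B. \<alpha> * x + (1 - \<alpha>) * y \<in> T"
    have cl: "compact (C \<inter> g -` X)" if "closed X" for X
      using C(1) continuous_closed_vimage [OF that, of g] g(1)
      by (auto intro!: compact_Int_closed simp: continuous_on_eq_continuous_at)
    define a b where "a = measure M (C \<inter> g -` A)" and "b = measure M (C \<inter> g -` B)"
    have ab: "measure N A = a / measure M C" "measure N B = b / measure M C"
      using * by (simp_all add: N a_def b_def)
    then have pos: "0 < a" "0 < b"
      using * C(3) by (auto simp: zero_less_divide_iff)
    have "power_mean s \<alpha> a b \<le> measure M {\<alpha> *\<^sub>R x + (1 - \<alpha>) *\<^sub>R y |x y. x \<in> C \<inter> g -` A \<and> y \<in> C \<inter> g -` B}"
      using conc cl [OF *(1)] cl [OF *(2)] pos *(6,7)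
      unfolding a_def b_def by (rule s_concaveD)
    also have "\<dots> \<le> measure M (C \<inter> g -` T)"
    proof (rule finite_measure_mono)
      show "{\<alpha> *\<^sub>R x + (1 - \<alpha>) *\<^sub>R y |x y. x \<in> C \<inter> g -` A \<and> y \<in> C \<inter> g -` B} \<subseteq> C \<inter> g -` T"
        using *(6-8) C(2) by (auto simp: g(2) convex_def)
      show "C \<inter> g -` T \<in> sets M"
        using cl [OF *(3)] by (simp add: M compact_imp_closed)
    qed
    finally have "power_mean s \<alpha> a b / measure M C \<le> measure M (C \<inter> g -` T) / measure M C"
      using C(3) by (simp add: divide_right_mono)
    then show "power_mean s \<alpha> (measure N A) (measure N B) \<le> measure N T"
      using * pos C(3) by (simp add: ab N power_mean_divide)
  qed
qed

section \<open>Bisection of dense bodies\<close>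

text \<open>The two inequalities are inherited by a half for different reasons: the one for
  \<open>A\<close> by balancing both halves, the strict one for \<open>F\<close> because it cannot
  fail in both. Strictness also excludes bodies of mass zero when
  \<open>0 \<le> \<kappa>\<close>.\<close>

definition dense_body :: "(real ^ 'n) measure \<Rightarrow> (real ^ 'n) set \<Rightarrow> (real ^ 'n) set \<Rightarrow> real \<Rightarrow> real \<Rightarrow> (real ^ 'n) set \<Rightarrow> bool"
  where "dense_body M A F p \<kappa> C \<longleftrightarrow> compact C \<and> convex C \<and>
    p * measure M C \<le> measure M (A \<inter> C) \<and> \<kappa> * measure M C < measure M (F \<inter> C)"

lemma dense_body_pos:
  assumes "dense_body M A F p \<kappa> C" "0 \<le> \<kappa>" "finite_measure M" "sets M = sets borel"
  shows "0 < measure M C"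
proof -
  interpret finite_measure M by fact
  have "0 \<le> \<kappa> * measure M C" using assms(2) by simp
  also have "\<dots> < measure M (F \<inter> C)" using assms(1) by (simp add: dense_body_def)
  also have "\<dots> \<le> measure M C"
    using assms(1,4) by (intro finite_measure_mono) (auto simp: dense_body_def compact_imp_closed)
  finally show ?thesis .
qed

text \<open>An \<open>s\<close>-concave measure charging a hyperplane lives on it, so a hyperplane charged by a dense
  body of least dimension contains that body.\<close>

lemma hyperplane_null:
  fixes M :: "(real ^ 'n) measure"
  assumes "prob_space M" and M: "sets M = sets borel" and conc: "s_concave s M"
    and "A \<in> sets borel" "F \<in> sets borel" "0 \<le> \<kappa>"
    and C: "dense_body M A F p \<kappa> C" and least: "\<And>C'. dense_body M A F p \<kappa> C' \<Longrightarrow> aff_dim C \<le> aff_dim C'"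
    and x: "x \<in> C" "v \<bullet> x \<noteq> c"
  shows "measure M (C \<inter> {x. v \<bullet> x = c}) = 0"
proof (rule ccontr)
  interpret prob_space M by fact
  assume "measure M (C \<inter> {x. v \<bullet> x = c}) \<noteq> 0"
  then have H: "0 < measure M (C \<inter> {x. v \<bullet> x = c})"
    by (simp add: zero_less_measure_iff)
  have C': "compact C" "convex C" "0 < measure M C"
    using C dense_body_pos [OF C \<open>0 \<le> \<kappa>\<close> finite_measure_axioms M] by (auto simp: dense_body_def)
  \<comment> \<open>A charged hyperplane is an atom of the law of \<open>v \<bullet> x\<close> on
    \<open>C\<close>, so the rest of \<open>C\<close> has no mass.\<close>
  define N where "N = distr (uniform_measure M C) borel ((\<bullet>) v)"
  have "continuous_on UNIV ((\<bullet>) v)" by (intro continuous_intros)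
  note N = pushforward_line_concave [OF assms(1) M conc C' this, folded N_def, simplified inner_add_right inner_scaleR_right, OF refl]
  interpret N: prob_space N by (rule N(1))
  have vim: "(\<bullet>) v -` {c} = {x. v \<bullet> x = c}" by auto
  have "0 < measure N {c}"
    using H C'(3) N(4) [of "{c}"] by (simp add: vim)
  then have "measure N (- {c}) = 0"
    by (rule line_concave_atom [OF N.finite_measure_axioms N(2,3)])
  then have off: "measure M (C \<inter> (\<bullet>) v -` (- {c})) = 0"
    using C'(3) N(4) [of "- {c}"] by simp
  define C2 where "C2 = C \<inter> {x. v \<bullet> x = c}"
  have C2: "compact C2" "convex C2"
    using C' unfolding C2_def
    by (auto intro!: compact_Int_closed convex_Int closed_hyperplane convex_hyperplane)
  have eq: "measure M (X \<inter> C) = measure M (X \<inter> C2)" if "X \<in> sets borel" for X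
  proof (rule antisym)
    have b: "C \<inter> (\<bullet>) v -` (- {c}) \<in> sets borel"
    proof -
      have "C \<inter> (\<bullet>) v -` (- {c}) = C - C2" by (auto simp: C2_def)
      then show ?thesis using C' C2 by (simp add: compact_imp_closed borel_closed sets.Diff)
    qed
    have "measure M (X \<inter> C) \<le> measure M ((X \<inter> C2) \<union> (C \<inter> (\<bullet>) v -` (- {c})))"
      using that b C2 by (intro finite_measure_mono) (auto simp: C2_def M compact_imp_closed)
    also have "\<dots> \<le> measure M (X \<inter> C2) + measure M (C \<inter> (\<bullet>) v -` (- {c}))"
      using that b C2 by (intro measure_Un_le) (auto simp: M compact_imp_closed)
    finally show "measure M (X \<inter> C) \<le> measure M (X \<inter> C2)" using off by simp
    show "measure M (X \<inter> C2) \<le> measure M (X \<inter> C)"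
      using that C' by (intro finite_measure_mono) (auto simp: C2_def M compact_imp_closed)
  qed
  \<comment> \<open>Discarding a null set changes none of the masses, but the section spans a
    smaller affine space, against the choice of \<open>C\<close>.\<close>
  have "dense_body M A F p \<kappa> C2"
    using C C2 eq [of A] eq [of F] eq [of UNIV] assms(4,5) by (simp add: dense_body_def)
  then have "aff_dim C \<le> aff_dim C2" by (rule least)
  moreover have "affine hull C2 \<subset> affine hull C"
  proof
    show "affine hull C2 \<subseteq> affine hull C" by (rule hull_mono) (auto simp: C2_def)
    have "affine hull C2 \<subseteq> {x. v \<bullet> x = c}"
      by (rule hull_minimal) (auto simp: C2_def affine_hyperplane)
    moreover have "x \<in> affine hull C" using x(1) by (rule hull_inc)
    ultimately show "affine hull C2 \<noteq> affine hull C" using x(2) by blast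
  qed
  then have "aff_dim C2 < aff_dim C" by (rule aff_dim_psubset)
  ultimately show False by simp
qed

text \<open>Turning the half-space by \<open>pi\<close> exchanges the two sides, so the difference
  of their surpluses of \<open>A\<close> changes sign and vanishes at some angle. There both
  surpluses are equal, hence nonnegative, and the inequality for \<open>F\<close> holds on at least
  one side. The angle ranges up to \<open>2 * pi\<close> because that side may be the opposite
  one.\<close>

lemma dense_body_bisect:
  fixes M :: "(real ^ 'n) measure" and u v z :: "real ^ 'n"
  assumes "finite_measure M" and M: "sets M = sets borel"
    and A: "A \<in> sets borel" and F: "F \<in> sets borel" and C: "dense_body M A F p \<kappa> C"
  defines "w \<equiv> \<lambda>\<theta>. cos \<theta> *\<^sub>R u + sin \<theta> *\<^sub>R v"
  assumes null: "\<And>\<theta>. measure M (C \<inter> {x. w \<theta> \<bullet> (x - z) = 0}) = 0"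
  shows "\<exists>\<theta>\<in>{0..2 * pi}. dense_body M A F p \<kappa> (C \<inter> {x. 0 \<le> w \<theta> \<bullet> (x - z)})"
proof -
  interpret finite_measure M by fact
  have sp: "space M = UNIV"
    using sets_eq_imp_space_eq [OF M] by simp
  have C': "compact C" "convex C" "closed C"
    using C by (auto simp: dense_body_def compact_imp_closed)
  define P Q where "P \<theta> = {x. 0 \<le> w \<theta> \<bullet> (x - z)}" and "Q \<theta> = {x. w \<theta> \<bullet> (x - z) \<le> 0}" for \<theta>
  have PQ_half: "P \<theta> = {x. w \<theta> \<bullet> x \<ge> w \<theta> \<bullet> z}" "Q \<theta> = {x. w \<theta> \<bullet> x \<le> w \<theta> \<bullet> z}" for \<theta>
    by (auto simp: P_def Q_def inner_diff_right)
  have PQ: "closed (P \<theta>)" "closed (Q \<theta>)" "convex (P \<theta>)" "convex (Q \<theta>)" for \<theta>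
    unfolding PQ_half
    by (simp_all add: closed_halfspace_ge closed_halfspace_le convex_halfspace_ge convex_halfspace_le)
  have Q_P: "Q \<theta> = P (\<theta> + pi)" for \<theta>
  proof -
    have "w (\<theta> + pi) = - w \<theta>" by (simp add: w_def)
    then show ?thesis by (simp add: P_def Q_def)
  qed
  have split: "measure M (X \<inter> C) = measure M (X \<inter> (C \<inter> P \<theta>)) + measure M (X \<inter> (C \<inter> Q \<theta>))"
    if "X \<in> sets borel" for X \<theta>
  proof -
    have [simp]: "X \<inter> (C \<inter> P \<theta>) \<in> sets M" "X \<inter> (C \<inter> Q \<theta>) \<in> sets M"
      using that C' PQ by (auto simp: M)
    have "measure M ((X \<inter> (C \<inter> P \<theta>)) \<inter> (X \<inter> (C \<inter> Q \<theta>))) \<le> measure M (C \<inter> {x. w \<theta> \<bullet> (x - z) = 0})"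
    proof (rule finite_measure_mono)
      have "C \<inter> {x. w \<theta> \<bullet> (x - z) = 0} = C \<inter> P \<theta> \<inter> Q \<theta>" by (auto simp: P_def Q_def)
      then show "C \<inter> {x. w \<theta> \<bullet> (x - z) = 0} \<in> sets M" using C' PQ by (simp add: M)
    qed (auto simp: P_def Q_def)
    then have "measure M ((X \<inter> (C \<inter> P \<theta>)) \<inter> (X \<inter> (C \<inter> Q \<theta>))) = 0"
      using null [of \<theta>] by (simp add: measure_le_0_iff)
    moreover have "X \<inter> C = (X \<inter> (C \<inter> P \<theta>)) \<union> (X \<inter> (C \<inter> Q \<theta>))"
      by (auto simp: P_def Q_def)
    ultimately show ?thesis
      using measure_Un3 [of "X \<inter> (C \<inter> P \<theta>)" M "X \<inter> (C \<inter> Q \<theta>)"] by (simp add: fmeasurable_eq_sets)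
  qed
  define \<Gamma> where "\<Gamma> X = measure M (A \<inter> X) - p * measure M X" for X
  \<comment> \<open>Written as one integrand, the difference depends on the angle only through
    \<open>sgn\<close>, which is continuous off the hyperplane. As the hyperplane meets
    \<open>C\<close> in a null set, dominated convergence gives continuity.\<close>
  define h where "h \<theta> x = (indicator A x - p) * indicator C x * sgn (w \<theta> \<bullet> (x - z))" for \<theta> x
  define D where "D \<theta> = (\<integral>x. h \<theta> x \<partial>M)" for \<theta>
  have D: "D \<theta> = \<Gamma> (C \<inter> P \<theta>) - \<Gamma> (C \<inter> Q \<theta>)" for \<theta>
  proof -
    have eq: "h \<theta> x = (indicator (A \<inter> (C \<inter> P \<theta>)) x - p * indicator (C \<inter> P \<theta>) x)
        - (indicator (A \<inter> (C \<inter> Q \<theta>)) x - p * indicator (C \<inter> Q \<theta>) x)" for x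
      by (auto simp: h_def P_def Q_def indicator_def sgn_if)
    have "A \<inter> (C \<inter> P \<theta>) \<in> sets M" "C \<inter> P \<theta> \<in> sets M" "A \<inter> (C \<inter> Q \<theta>) \<in> sets M" "C \<inter> Q \<theta> \<in> sets M"
      using A C' PQ by (auto simp: M)
    moreover have "integrable M (indicat_real S)" if "S \<in> sets M" for S
      by (rule integrable_real_indicator) (simp_all add: that less_top [symmetric])
    ultimately show ?thesis
      unfolding D_def eq \<Gamma>_def by (simp add: sp)
  qed
  have "continuous_on {0..pi} D"
  proof (rule continuous_on_sequentiallyI)
    fix \<phi> :: "nat \<Rightarrow> real" and \<theta> :: real assume \<phi>: "\<phi> \<longlonglongrightarrow> \<theta>"
    have wlim: "(\<lambda>n. w (\<phi> n) \<bullet> (x - z)) \<longlonglongrightarrow> w \<theta> \<bullet> (x - z)" for x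
      unfolding w_def by (intro tendsto_intros \<phi>)
    have hM: "h \<theta> \<in> borel_measurable M" for \<theta>
    proof -
      have "h \<theta> \<in> borel_measurable borel"
        unfolding h_def using A C'
        by (intro borel_measurable_times borel_measurable_diff borel_measurable_indicator
            borel_measurable_const measurable_compose [OF _ borel_measurable_sgn]
            borel_measurable_continuous_onI) (auto intro!: continuous_intros)
      then show ?thesis by (simp add: measurable_def sp M)
    qed
    show "(\<lambda>n. D (\<phi> n)) \<longlonglongrightarrow> D \<theta>"
      unfolding D_def
    proof (rule integral_dominated_convergence [where w = "\<lambda>_. 1 + \<bar>p\<bar>"])
      show "AE x in M. (\<lambda>n. h (\<phi> n) x) \<longlonglongrightarrow> h \<theta> x"
      proof (rule AE_I')
        have "C \<inter> {x. w \<theta> \<bullet> (x - z) = 0} = C \<inter> P \<theta> \<inter> Q \<theta>" by (auto simp: P_def Q_def)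
        then have "C \<inter> {x. w \<theta> \<bullet> (x - z) = 0} \<in> sets M" using C' PQ by (simp add: M)
        then show "C \<inter> {x. w \<theta> \<bullet> (x - z) = 0} \<in> null_sets M"
          using null [of \<theta>] by (simp add: null_sets_def emeasure_eq_measure)
        have "(\<lambda>n. h (\<phi> n) x) \<longlonglongrightarrow> h \<theta> x" if "x \<notin> C \<or> w \<theta> \<bullet> (x - z) \<noteq> 0" for x
        proof (cases "x \<in> C")
          case True
          then show ?thesis
            unfolding h_def using that by (intro tendsto_mult tendsto_const tendsto_sgn wlim) auto
        qed (simp add: h_def)
        then show "{x \<in> space M. \<not> (\<lambda>n. h (\<phi> n) x) \<longlonglongrightarrow> h \<theta> x} \<subseteq> C \<inter> {x. w \<theta> \<bullet> (x - z) = 0}"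
          by auto
      qed
      show "AE x in M. norm (h (\<phi> n) x) \<le> 1 + \<bar>p\<bar>" for n
        by (rule AE_I2) (auto simp: h_def indicator_def sgn_if abs_mult)
    qed (auto simp: hM)
  qed
  moreover have "D pi = - D 0"
    by (simp add: D_def h_def w_def sgn_minus)
  ultimately obtain \<theta> where \<theta>: "0 \<le> \<theta>" "\<theta> \<le> pi" "D \<theta> = 0"
    using IVT' [of D 0 0 pi] IVT2' [of D pi 0 0] pi_ge_zero by (cases "D 0 \<le> 0") auto
  have "\<Gamma> C = \<Gamma> (C \<inter> P \<theta>) + \<Gamma> (C \<inter> Q \<theta>)"
    using split [OF A, of \<theta>] split [of UNIV \<theta>] by (simp add: \<Gamma>_def algebra_simps)
  moreover have "0 \<le> \<Gamma> C" using C by (simp add: \<Gamma>_def dense_body_def)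
  moreover have "\<Gamma> (C \<inter> P \<theta>) = \<Gamma> (C \<inter> Q \<theta>)" using \<theta>(3) D by simp
  ultimately have \<Gamma>: "0 \<le> \<Gamma> (C \<inter> P \<theta>)" "0 \<le> \<Gamma> (C \<inter> Q \<theta>)" by auto
  have "\<kappa> * measure M (C \<inter> P \<theta>) + \<kappa> * measure M (C \<inter> Q \<theta>) < measure M (F \<inter> (C \<inter> P \<theta>)) + measure M (F \<inter> (C \<inter> Q \<theta>))"
    using C split [OF F, of \<theta>] split [of UNIV \<theta>] by (simp add: dense_body_def algebra_simps)
  then consider "\<kappa> * measure M (C \<inter> P \<theta>) < measure M (F \<inter> (C \<inter> P \<theta>))"
    | "\<kappa> * measure M (C \<inter> Q \<theta>) < measure M (F \<inter> (C \<inter> Q \<theta>))" by linarith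
  then show ?thesis
  proof cases
    case 1
    then have "dense_body M A F p \<kappa> (C \<inter> P \<theta>)"
      using \<Gamma> C' PQ by (simp add: dense_body_def \<Gamma>_def compact_Int_closed convex_Int)
    then show ?thesis using \<theta> by (intro bexI [of _ \<theta>]) (simp_all add: P_def)
  next
    case 2
    then have "dense_body M A F p \<kappa> (C \<inter> P (\<theta> + pi))"
      using \<Gamma> C' PQ unfolding Q_P [symmetric] by (simp add: dense_body_def \<Gamma>_def compact_Int_closed convex_Int)
    then show ?thesis using \<theta> by (intro bexI [of _ "\<theta> + pi"]) (simp_all add: P_def)
  qed
qed

section \<open>Minimal limits of dense bodies\<close>

text \<open>A one-sided substitute for a Hausdorff limit: \<open>S\<close> itself need not satisfy
  \<open>Q\<close>, and the approximating sets need not come near every point of \<open>S\<close>.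
  Phrased with open supersets, it is stable under intersections of chains.\<close>

definition limit_body :: "('a::euclidean_space set \<Rightarrow> bool) \<Rightarrow> 'a set \<Rightarrow> bool" where
  "limit_body Q S \<longleftrightarrow> compact S \<and> convex S \<and> (\<forall>U. open U \<longrightarrow> S \<subseteq> U \<longrightarrow> (\<exists>C. Q C \<and> C \<subseteq> U))"

text \<open>By compactness, an open set containing the intersection already contains a member of the
  chain: otherwise the compact nonempty sets \<open>S - U\<close> would have a common point.\<close>

lemma limit_body_Inter:
  assumes "\<S> \<noteq> {}" and lim: "\<And>S. S \<in> \<S> \<Longrightarrow> limit_body Q S"
    and chain: "\<And>S T. S \<in> \<S> \<Longrightarrow> T \<in> \<S> \<Longrightarrow> S \<subseteq> T \<or> T \<subseteq> S"
  shows "limit_body Q (\<Inter>\<S>)"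
proof -
  have S: "compact S" "convex S" if "S \<in> \<S>" for S
    using lim [OF that] by (simp_all add: limit_body_def)
  have "compact (\<Inter>\<S>)"
    using S \<open>\<S> \<noteq> {}\<close> by (intro compact_Inter) simp_all
  moreover have "convex (\<Inter>\<S>)"
    using S by (intro convex_Inter) simp
  moreover have "\<exists>C. Q C \<and> C \<subseteq> U" if U: "open U" "\<Inter>\<S> \<subseteq> U" for U
  proof -
    have "\<exists>S\<in>\<S>. S \<subseteq> U"
    proof (rule ccontr)
      assume no: "\<not> (\<exists>S\<in>\<S>. S \<subseteq> U)"
      have "\<Inter>((\<lambda>S. S - U) ` \<S>) \<noteq> {}"
      proof (rule compact_chain)
        show "compact S" if "S \<in> (\<lambda>S. S - U) ` \<S>" for S
          using that S U by (elim imageE) (simp add: compact_diff)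
        show "{} \<notin> (\<lambda>S. S - U) ` \<S>"
          using no by (metis Diff_eq_empty_iff imageE)
        show "S \<subseteq> T \<or> T \<subseteq> S" if ST: "S \<in> (\<lambda>S. S - U) ` \<S> \<and> T \<in> (\<lambda>S. S - U) ` \<S>" for S T
        proof -
          obtain S' where "S = S' - U" "S' \<in> \<S>"
            using conjunct1 [OF ST] by (rule imageE)
          moreover obtain T' where "T = T' - U" "T' \<in> \<S>"
            using conjunct2 [OF ST] by (rule imageE)
          ultimately show ?thesis using chain [of S' T'] Diff_mono by (metis order_refl)
        qed
      qed
      then obtain x where "x \<in> \<Inter>((\<lambda>S. S - U) ` \<S>)" by blast
      then have "x \<in> \<Inter>\<S>" "x \<notin> U" using \<open>\<S> \<noteq> {}\<close> by auto
      then show False using U by blast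
    qed
    then obtain S where "S \<in> \<S>" "S \<subseteq> U" by blast
    then show ?thesis
      using lim [of S] U(1) unfolding limit_body_def by blast
  qed
  ultimately show ?thesis by (simp add: limit_body_def)
qed

lemma limit_body_minimal:
  assumes C0: "Q C0" "compact C0" "convex C0"
  obtains S where "limit_body Q S" "S \<subseteq> C0" "\<And>S'. limit_body Q S' \<Longrightarrow> S' \<subseteq> S \<Longrightarrow> S' = S"
proof -
  \<comment> \<open>Passing to complements turns a minimal limit into a maximal set, as
    \<open>subset_Zorn\<close> supplies.\<close>
  define \<A> where "\<A> = uminus ` {S. limit_body Q S \<and> S \<subseteq> C0}"
  have ub: "\<exists>U\<in>\<A>. \<forall>X\<in>\<C>. X \<subseteq> U" if \<C>: "subset.chain \<A> \<C>" for \<C>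
  proof (cases "\<C> = {}")
    case True
    have "limit_body Q C0" using C0 by (auto simp: limit_body_def)
    then show ?thesis using True by (auto simp: \<A>_def)
  next
    case False
    have sub: "\<C> \<subseteq> \<A>" and ch: "\<And>X Y. X \<in> \<C> \<Longrightarrow> Y \<in> \<C> \<Longrightarrow> X \<subseteq> Y \<or> Y \<subseteq> X"
      using \<C> by (auto simp: subset_chain_def)
    have mem: "limit_body Q (- X)" "- X \<subseteq> C0" if "X \<in> \<C>" for X
      using subsetD [OF sub that] by (auto simp: \<A>_def)
    define T where "T = \<Inter>(uminus ` \<C>)"
    have "limit_body Q T"
      unfolding T_def
    proof (rule limit_body_Inter)
      show "limit_body Q S" if "S \<in> uminus ` \<C>" for S
        using that mem(1) by (elim imageE) simp
      show "S \<subseteq> T \<or> T \<subseteq> S" if ST: "S \<in> uminus ` \<C>" "T \<in> uminus ` \<C>" for S T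
      proof -
        obtain X where "S = - X" "X \<in> \<C>"
          using ST(1) by (rule imageE)
        moreover obtain Y where "T = - Y" "Y \<in> \<C>"
          using ST(2) by (rule imageE)
        ultimately show ?thesis using ch [of X Y] by (simp add: disj_commute)
      qed
    qed (use False in simp)
    moreover obtain X where "X \<in> \<C>" using False by blast
    then have "T \<subseteq> C0"
      using mem(2) [of X] unfolding T_def by (meson INF_lower order_trans)
    ultimately have "- T \<in> \<A>" by (simp add: \<A>_def)
    moreover have "X \<subseteq> - T" if "X \<in> \<C>" for X
      using that by (auto simp: T_def)
    ultimately show ?thesis by blast
  qed
  obtain X where X: "X \<in> \<A>" "\<And>Y. Y \<in> \<A> \<Longrightarrow> X \<subseteq> Y \<Longrightarrow> Y = X"
    using subset_Zorn [OF ub] by blast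
  then obtain S where S: "X = - S" "limit_body Q S" "S \<subseteq> C0" by (auto simp: \<A>_def)
  show thesis
  proof (rule that [OF S(2,3)])
    fix S' assume "limit_body Q S'" "S' \<subseteq> S"
    then have "limit_body Q S' \<and> S' \<subseteq> C0" using S(3) by simp
    then have "- S' \<in> \<A>" by (simp add: \<A>_def)
    moreover have "X \<subseteq> - S'" using S(1) \<open>S' \<subseteq> S\<close> by simp
    ultimately have "- S' = X" by (rule X(2))
    then show "S' = S" using S(1) by simp
  qed
qed

text \<open>Take two edges u, v of a nondegenerate triangle in \<open>S\<close> and its centroid z.
  A normal on the circle is a nonzero combination of u and v, so it is not constant on the vertices;
  its mean over them is its value at z, and some vertex lies strictly on the negative side.\<close>

lemma noncollinear_normals:
  fixes S :: "'a::euclidean_space set"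
  assumes "convex S" "\<not> collinear S"
  obtains u v z where "z \<in> S"
    "\<And>\<theta>. \<exists>x\<in>S. (cos \<theta> *\<^sub>R u + sin \<theta> *\<^sub>R v) \<bullet> (x - z) < 0"
proof -
  obtain a b where ab: "a \<in> S" "b \<in> S" "a \<noteq> b"
    using assms(2) unfolding collinear_def by (metis diff_self scale_zero_left)
  then have "insert a (insert b S) = S" by auto
  then obtain c where c: "c \<in> S" "\<not> collinear {a, b, c}"
    using collinear_triples [OF ab(3), of S] assms(2) by auto
  define u v where "u = b - a" and "v = c - a"
  define z where "z = (1/3) *\<^sub>R a + (1/3) *\<^sub>R b + (1/3) *\<^sub>R c"
  have "collinear {b, a, c} = collinear {0, u, v}"
    unfolding u_def v_def by (rule collinear_3) (simp add: NO_MATCH_def)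
  moreover have "{b, a, c} = {a, b, c}" by auto
  ultimately have uv: "\<not> collinear {0, u, v}"
    using c(2) by simp
  have "z \<in> S"
  proof -
    have "(1/2) *\<^sub>R a + (1/2) *\<^sub>R b \<in> S"
      using assms(1) ab by (intro convexD) auto
    then have "(2/3) *\<^sub>R ((1/2) *\<^sub>R a + (1/2) *\<^sub>R b) + (1/3) *\<^sub>R c \<in> S"
      by (rule convexD [OF assms(1) _ c(1)]) simp_all
    then show ?thesis by (simp add: z_def algebra_simps)
  qed
  moreover have "\<exists>x\<in>S. (cos \<theta> *\<^sub>R u + sin \<theta> *\<^sub>R v) \<bullet> (x - z) < 0" for \<theta>
  proof (rule ccontr)
    define w where "w = cos \<theta> *\<^sub>R u + sin \<theta> *\<^sub>R v"
    assume "\<not> ?thesis"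
    then have ge: "w \<bullet> z \<le> w \<bullet> a" "w \<bullet> z \<le> w \<bullet> b" "w \<bullet> z \<le> w \<bullet> c"
      using ab c by (auto simp: w_def [symmetric] inner_diff_right not_less)
    have "3 * (w \<bullet> z) = w \<bullet> a + w \<bullet> b + w \<bullet> c"
      by (simp add: z_def inner_add_right)
    with ge have "w \<bullet> a = w \<bullet> z" "w \<bullet> b = w \<bullet> z" "w \<bullet> c = w \<bullet> z" by auto
    then have "w \<bullet> u = 0" "w \<bullet> v = 0" by (simp_all add: u_def v_def inner_diff_right)
    then have "w \<bullet> w = 0"
      by (subst (2) w_def) (simp add: inner_add_right)
    then have "w = 0" by simp
    have "u \<noteq> 0" "v \<noteq> 0" using uv by (auto simp: collinear_lemma)
    show False
    proof (cases "sin \<theta> = 0")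
      case True
      then have "cos \<theta> \<noteq> 0" using sin_cos_squared_add [of \<theta>] by force
      then show False using True \<open>w = 0\<close> \<open>u \<noteq> 0\<close> by (simp add: w_def)
    next
      case False
      have "sin \<theta> *\<^sub>R v = (- cos \<theta>) *\<^sub>R u"
        using \<open>w = 0\<close> by (simp add: w_def add_eq_0_iff)
      then have "inverse (sin \<theta>) *\<^sub>R (sin \<theta> *\<^sub>R v) = inverse (sin \<theta>) *\<^sub>R ((- cos \<theta>) *\<^sub>R u)" by simp
      then have "v = (- (inverse (sin \<theta>) * cos \<theta>)) *\<^sub>R u"
        using False by simp
      then show False using uv unfolding collinear_lemma by blast
    qed
  qed
  ultimately show thesis by (rule that)
qed

text \<open>Bodies closer and closer to \<open>S\<close> are cut through z, and along a subsequence
  the angles converge. Cutting \<open>S\<close> itself at the limit angle gives a new limit, and a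
  proper subset, because every half-space through z in question misses a point of \<open>S\<close>.
  The assumption \<open>cut\<close> asks for points off the hyperplane in \<open>C0\<close> only,
  since the approximating bodies vary.\<close>

lemma limit_body_cut:
  fixes S :: "'a::euclidean_space set"
  assumes C0: "compact C0" "\<And>C. Q C \<Longrightarrow> C \<subseteq> C0" "\<not> Q {}"
    and cut: "\<And>C u v z. Q C \<Longrightarrow> (\<And>\<theta>. \<exists>x\<in>C0. (cos \<theta> *\<^sub>R u + sin \<theta> *\<^sub>R v) \<bullet> (x - z) \<noteq> 0) \<Longrightarrow>
      \<exists>\<theta>\<in>{0..2 * pi}. Q (C \<inter> {x. 0 \<le> (cos \<theta> *\<^sub>R u + sin \<theta> *\<^sub>R v) \<bullet> (x - z)})"
    and S: "limit_body Q S" "S \<subseteq> C0" "\<not> collinear S"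
  shows "\<exists>S'. limit_body Q S' \<and> S' \<subset> S"
proof -
  have S': "compact S" "convex S" "closed S" "S \<noteq> {}"
    using S by (auto simp: limit_body_def compact_imp_closed)
  obtain u v z where z: "z \<in> S" "\<And>\<theta>. \<exists>x\<in>S. (cos \<theta> *\<^sub>R u + sin \<theta> *\<^sub>R v) \<bullet> (x - z) < 0"
    using noncollinear_normals [OF S'(2) S(3)] by metis
  define w where "w \<theta> = cos \<theta> *\<^sub>R u + sin \<theta> *\<^sub>R v" for \<theta>
  have "\<exists>C \<theta>. C \<subseteq> {x. infdist x S < 1 / Suc n} \<and> \<theta> \<in> {0..2 * pi} \<and> Q (C \<inter> {x. 0 \<le> w \<theta> \<bullet> (x - z)})" for n
  proof -
    have "open {x. infdist x S < 1 / Suc n}"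
      by (intro open_Collect_less continuous_intros)
    moreover have "S \<subseteq> {x. infdist x S < 1 / Suc n}" by auto
    ultimately obtain C where C: "Q C" "C \<subseteq> {x. infdist x S < 1 / Suc n}"
      using S(1) unfolding limit_body_def by blast
    have "\<exists>x\<in>C0. (cos \<theta> *\<^sub>R u + sin \<theta> *\<^sub>R v) \<bullet> (x - z) \<noteq> 0" for \<theta>
      using z(2) [of \<theta>] S(2) by force
    from cut [OF C(1) this] C(2) show ?thesis
      unfolding w_def by blast
  qed
  then obtain C \<theta> where C: "\<And>n. C n \<subseteq> {x. infdist x S < 1 / Suc n}" "\<And>n. \<theta> n \<in> {0..2 * pi}"
      "\<And>n. Q (C n \<inter> {x. 0 \<le> w (\<theta> n) \<bullet> (x - z)})"
    by metis
  obtain \<phi> r where r: "strict_mono (r :: nat \<Rightarrow> nat)" "(\<theta> \<circ> r) \<longlonglongrightarrow> \<phi>"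
    using C(2) compact_Icc [of 0 "2 * pi"] unfolding compact_def by (metis atLeastAtMost_iff)
  define T where "T = S \<inter> {x. 0 \<le> w \<phi> \<bullet> (x - z)}"
  have half: "{x. 0 \<le> w \<phi> \<bullet> (x - z)} = {x. w \<phi> \<bullet> x \<ge> w \<phi> \<bullet> z}"
    by (auto simp: inner_diff_right)
  have "limit_body Q T"
    unfolding limit_body_def
  proof (intro conjI allI impI)
    show "compact T" "convex T"
      unfolding T_def half using S'
      by (auto intro!: compact_Int_closed convex_Int closed_halfspace_ge convex_halfspace_ge)
    fix U :: "'a set" assume U: "open U" "T \<subseteq> U"
    define B where "B n = C (r n) \<inter> {x. 0 \<le> w (\<theta> (r n)) \<bullet> (x - z)}" for n
    \<comment> \<open>Otherwise points of the cut bodies outside \<open>U\<close> accumulate at a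
      point of \<open>S\<close> in the limiting closed half-space, that is in \<open>T\<close>,
      although the complement of \<open>U\<close> is closed.\<close>
    have "\<exists>n. B n \<subseteq> U"
    proof (rule ccontr)
      assume "\<nexists>n. B n \<subseteq> U"
      then have "\<forall>n. \<exists>x. x \<in> B n \<and> x \<notin> U" by blast
      then obtain x where x: "\<And>n. x n \<in> B n" "\<And>n. x n \<notin> U"
        by metis
      have "x n \<in> C0" for n
        using x(1) [of n] C0(2) [OF C(3) [of "r n"]] by (auto simp: B_def)
      then obtain y q where q: "strict_mono (q :: nat \<Rightarrow> nat)" "(x \<circ> q) \<longlonglongrightarrow> y"
        using C0(1) unfolding compact_def by metis
      have "y \<in> S"
      proof -
        have "infdist (x (q n)) S \<le> 1 / Suc n" for n
        proof -
          have "infdist (x (q n)) S < 1 / Suc (r (q n))"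
            using x(1) [of "q n"] C(1) [of "r (q n)"] by (auto simp: B_def)
          moreover have "n \<le> r (q n)"
            using seq_suble [OF r(1), of "q n"] seq_suble [OF q(1), of n] by simp
          then have "1 / real (Suc (r (q n))) \<le> 1 / Suc n"
            by (intro divide_left_mono) auto
          ultimately show ?thesis by linarith
        qed
        then have "infdist y S \<le> 0"
          using q(2) by (intro LIMSEQ_le [OF tendsto_infdist LIMSEQ_Suc [OF lim_1_over_n]]) (auto simp: o_def)
        then show ?thesis
          using S' in_closed_iff_infdist_zero infdist_nonneg [of y S] by (metis order_antisym)
      qed
      moreover have "0 \<le> w \<phi> \<bullet> (y - z)"
      proof (rule LIMSEQ_le_const)
        have "(\<lambda>n. \<theta> (r (q n))) \<longlonglongrightarrow> \<phi>"
          using LIMSEQ_subseq_LIMSEQ [OF r(2) q(1)] by (simp add: o_def)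
        then show "(\<lambda>n. w (\<theta> (r (q n))) \<bullet> (x (q n) - z)) \<longlonglongrightarrow> w \<phi> \<bullet> (y - z)"
          unfolding w_def using q(2) by (intro tendsto_intros) (auto simp: o_def)
        show "\<exists>N. \<forall>n\<ge>N. 0 \<le> w (\<theta> (r (q n))) \<bullet> (x (q n) - z)"
          using x(1) by (auto simp: B_def)
      qed
      ultimately have "y \<in> U" using U(2) by (auto simp: T_def)
      moreover have "y \<in> - U"
        using closed_sequentially [of "- U" "x \<circ> q" y] U(1) x(2) q(2) by auto
      ultimately show False by simp
    qed
    then show "\<exists>C. Q C \<and> C \<subseteq> U"
      using C(3) by (auto simp: B_def)
  qed
  moreover have "T \<subset> S"
  proof -
    obtain x where "x \<in> S" "w \<phi> \<bullet> (x - z) < 0"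
      using z(2) [of \<phi>] by (auto simp: w_def)
    then have "x \<in> S - T" by (simp add: T_def)
    then show ?thesis by (auto simp: T_def)
  qed
  ultimately show ?thesis by blast
qed

text \<open>A minimal limit of dense subbodies of a dense body of least dimension is a segment: the hyperplane
  through its interior could otherwise be turned until it bisects, leaving a smaller limit.\<close>

lemma needle:
  fixes M :: "(real ^ 'n) measure"
  assumes "prob_space M" and M: "sets M = sets borel" and conc: "s_concave s M"
    and AF: "A \<in> sets borel" "F \<in> sets borel" and "0 \<le> \<kappa>"
    and ex: "dense_body M A F p \<kappa> C"
  obtains S where "collinear S" "limit_body (dense_body M A F p \<kappa>) S"
proof -
  interpret prob_space M by fact
  let ?d = "dense_body M A F p \<kappa>"
  \<comment> \<open>\<open>aff_dim\<close> is an integer that is at least -1; the shift by one makes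
    it a natural number, for which a least value exists.\<close>
  obtain C0 where C0: "?d C0" "\<And>C'. ?d C' \<Longrightarrow> nat (aff_dim C0 + 1) \<le> nat (aff_dim C' + 1)"
    using ex_has_least_nat [of ?d C "\<lambda>C. nat (aff_dim C + 1)"] ex by blast
  have least: "aff_dim C0 \<le> aff_dim C'" if "?d C'" for C'
    using C0(2) [OF that] aff_dim_geq [of C'] aff_dim_geq [of C0] by linarith
  \<comment> \<open>Confining the bodies to \<open>C0\<close> lets them inherit null hyperplanes
    from it, whatever their own dimension.\<close>
  define Q where "Q C \<longleftrightarrow> ?d C \<and> C \<subseteq> C0" for C
  have C0': "compact C0" "convex C0" using C0 by (auto simp: dense_body_def)
  have "Q C0" using C0 by (simp add: Q_def)
  then obtain S where S: "limit_body Q S" "S \<subseteq> C0" "\<And>S'. limit_body Q S' \<Longrightarrow> S' \<subseteq> S \<Longrightarrow> S' = S"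
    using limit_body_minimal C0' by metis
  have "collinear S"
  proof (rule ccontr)
    assume "\<not> collinear S"
    have "\<exists>S'. limit_body Q S' \<and> S' \<subset> S"
    proof (rule limit_body_cut [OF C0'(1) _ _ _ S(1,2) \<open>\<not> collinear S\<close>])
      show "\<not> Q {}" by (auto simp: Q_def dense_body_def)
      fix C u v and z :: "real ^ 'n"
      assume C: "Q C" and off: "\<And>\<theta>. \<exists>x\<in>C0. (cos \<theta> *\<^sub>R u + sin \<theta> *\<^sub>R v) \<bullet> (x - z) \<noteq> 0"
      have "measure M (C \<inter> {x. (cos \<theta> *\<^sub>R u + sin \<theta> *\<^sub>R v) \<bullet> (x - z) = 0}) = 0" for \<theta>
      proof -
        define w where "w = cos \<theta> *\<^sub>R u + sin \<theta> *\<^sub>R v"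
        obtain x where x: "x \<in> C0" "w \<bullet> x \<noteq> w \<bullet> z"
          using off [of \<theta>] by (auto simp: w_def [symmetric] inner_diff_right)
        have "measure M (C \<inter> {x. w \<bullet> (x - z) = 0}) \<le> measure M (C0 \<inter> {x. w \<bullet> x = w \<bullet> z})"
          using C C0'(1) by (intro finite_measure_mono)
            (auto simp: Q_def M inner_diff_right compact_imp_closed closed_hyperplane)
        also have "\<dots> = 0"
          using hyperplane_null [OF assms(1) M conc AF \<open>0 \<le> \<kappa>\<close> C0(1) least x] .
        finally show ?thesis by (simp add: measure_le_0_iff w_def)
      qed
      then obtain \<theta> where "\<theta> \<in> {0..2 * pi}" "?d (C \<inter> {x. 0 \<le> (cos \<theta> *\<^sub>R u + sin \<theta> *\<^sub>R v) \<bullet> (x - z)})"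
        using dense_body_bisect [OF finite_measure_axioms M AF, of p \<kappa> C u v z] C by (auto simp: Q_def)
      then show "\<exists>\<theta>\<in>{0..2 * pi}. Q (C \<inter> {x. 0 \<le> (cos \<theta> *\<^sub>R u + sin \<theta> *\<^sub>R v) \<bullet> (x - z)})"
        using C by (auto simp: Q_def)
    qed (simp add: Q_def)
    then show False using S(3) by blast
  qed
  moreover have "limit_body ?d S"
    using S(1) unfolding limit_body_def Q_def by blast
  ultimately show thesis by (rule that)
qed

section \<open>From needles to the bound\<close>

definition fatten :: "real \<Rightarrow> real set \<Rightarrow> real set" where
  "fatten r X = (\<Union>x\<in>X. cball x r)"

lemma mem_fatten: "t \<in> fatten r X \<longleftrightarrow> (\<exists>x\<in>X. \<bar>t - x\<bar> \<le> r)"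
  by (simp add: fatten_def dist_real_def abs_minus_commute)

lemma compact_fatten: "compact X \<Longrightarrow> compact (fatten r X)"
  unfolding fatten_def by (rule compact_minkowski_sum_cball)

lemma compact_imp_fmeasurable_lborel:
  fixes X :: "'a::euclidean_space set"
  assumes "compact X"
  shows "X \<in> fmeasurable lborel"
  using assms emeasure_bounded_finite [OF compact_imp_bounded [OF assms]]
  by (simp add: fmeasurable_def compact_imp_closed borel_closed)

lemma measure_closed_segment_real: "measure lborel (closed_segment x y) = \<bar>y - x\<bar>" for x y :: real
  by (auto simp: closed_segment_eq_real_ivl)

text \<open>Fattening costs a fixed length, whereas the allowance (\<delta>' - \<delta>) * |y - a|
  grows with the segment. A segment that starts near \<open>A\<close> and meets the fattened
  \<open>F\<close> has length at least d / 2, because \<open>A\<close> and \<open>F\<close> are a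
  distance d apart, and this pays for the cost.\<close>

lemma fatten_segments:
  fixes A F :: "real set"
  assumes A: "compact A" and F: "compact F" and disj: "A \<inter> F = {}" and \<delta>: "0 \<le> \<delta>" "\<delta> < \<delta>'"
    and seg: "\<And>a y. a \<in> A \<Longrightarrow> measure lborel (F \<inter> closed_segment a y) \<le> \<delta> * \<bar>y - a\<bar>"
  obtains r where "0 < r" "fatten r F \<inter> fatten r A = {}"
    "\<And>a y. a \<in> fatten r A \<Longrightarrow> measure lborel (fatten (2 * r) F \<inter> closed_segment a y) \<le> \<delta>' * \<bar>y - a\<bar>"
proof -
  obtain d where d: "0 < d" "\<And>x y. x \<in> A \<Longrightarrow> y \<in> F \<Longrightarrow> d \<le> \<bar>x - y\<bar>"
    using separate_compact_closed [OF A compact_imp_closed [OF F] disj] by (auto simp: dist_real_def)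
  \<comment> \<open>On the shortest relevant segment the allowance is (\<delta>' - \<delta>) * (d /
    2) = 2 * \<eta>: one \<eta> for the excess of the open set \<open>T\<close> over
    \<open>F\<close>, one for moving the starting point.\<close>
  define \<eta> where "\<eta> = d * (\<delta>' - \<delta>) / 4"
  have "0 < \<eta>" using d \<delta> by (simp add: \<eta>_def)
  have "F \<in> sets lebesgue" using F by (simp add: compact_imp_closed borel_closed)
  then obtain T where T: "open T" "F \<subseteq> T" "T - F \<in> lmeasurable" "emeasure lebesgue (T - F) < ennreal \<eta>"
    using sets_lebesgue_outer_open \<open>0 < \<eta>\<close> by blast
  have T_less: "measure lebesgue (T - F) < \<eta>"
    using T(4) unfolding emeasure_eq_measure2 [OF T(3)] by (simp add: ennreal_less_iff)
  have Tb: "T - F \<in> sets lborel" using T(1) F by (simp add: borel_open borel_closed compact_imp_closed sets.Diff)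
  obtain \<rho> where \<rho>: "0 < \<rho>" "(\<Union>x\<in>F. cball x \<rho>) \<subseteq> T"
    using compact_subset_open_imp_cball_epsilon_subset [OF F T(1,2)] by blast
  \<comment> \<open>The three bounds keep the fattening by 2 * r inside \<open>T\<close>, leave d -
    3 * r \<ge> d / 2, and make the cost r + \<delta> * r of the moved starting point at most
    \<eta>.\<close>
  define r where "r = min (\<rho> / 2) (min (d / 6) (\<eta> / (1 + \<delta>)))"
  have r: "0 < r" "2 * r \<le> \<rho>" "6 * r \<le> d"
  proof -
    have "0 < \<eta> / (1 + \<delta>)" using \<delta> \<open>0 < \<eta>\<close> by simp
    then show "0 < r" "2 * r \<le> \<rho>" "6 * r \<le> d"
      using \<rho>(1) d(1) unfolding r_def by linarith+
  qed
  have "r \<le> \<eta> / (1 + \<delta>)" by (simp add: r_def)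
  then have r\<eta>: "r + \<delta> * r \<le> \<eta>" using \<delta> by (simp add: pos_le_divide_eq algebra_simps)
  show thesis
  proof (rule that [OF r(1)])
    show "fatten r F \<inter> fatten r A = {}"
    proof (rule ccontr)
      assume "fatten r F \<inter> fatten r A \<noteq> {}"
      then obtain t x y where "x \<in> A" "y \<in> F" "\<bar>t - x\<bar> \<le> r" "\<bar>t - y\<bar> \<le> r"
        by (auto simp: mem_fatten)
      with d(2) [of x y] r show False by linarith
    qed
    fix a y assume "a \<in> fatten r A"
    then obtain x where x: "x \<in> A" "\<bar>a - x\<bar> \<le> r" by (auto simp: mem_fatten)
    show "measure lborel (fatten (2 * r) F \<inter> closed_segment a y) \<le> \<delta>' * \<bar>y - a\<bar>"
    proof (cases "fatten (2 * r) F \<inter> closed_segment a y = {}")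
      case True
      then show ?thesis using \<delta> by simp
    next
      case False
      then obtain t f where t: "f \<in> F" "\<bar>t - f\<bar> \<le> 2 * r" "t \<in> closed_segment a y"
        by (auto simp: mem_fatten)
      have "\<bar>t - a\<bar> \<le> \<bar>y - a\<bar>"
        using t(3) by (auto simp: closed_segment_eq_real_ivl split: if_splits)
      then have far: "d / 2 \<le> \<bar>y - a\<bar>"
        using d(2) [OF x(1) t(1)] t(2) x(2) r by linarith
      have "fatten (2 * r) F \<subseteq> T"
      proof
        fix t assume "t \<in> fatten (2 * r) F"
        then obtain f where "f \<in> F" "\<bar>t - f\<bar> \<le> 2 * r" by (auto simp: mem_fatten)
        then have "t \<in> (\<Union>x\<in>F. cball x \<rho>)" using r by (auto simp: dist_real_def intro!: bexI [of _ f])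
        then show "t \<in> T" using \<rho> by blast
      qed
      moreover have "closed_segment a y \<subseteq> closed_segment x y \<union> closed_segment a x"
        by (auto simp: closed_segment_eq_real_ivl)
      ultimately have "fatten (2 * r) F \<inter> closed_segment a y
          \<subseteq> (T - F) \<union> ((F \<inter> closed_segment x y) \<union> closed_segment a x)"
        by blast
      moreover have fin: "T - F \<in> fmeasurable lborel" "F \<inter> closed_segment x y \<in> fmeasurable lborel"
          "closed_segment a x \<in> fmeasurable lborel"
      proof -
        show "T - F \<in> fmeasurable lborel"
          using T(3) Tb by (simp add: fmeasurable_def)
      qed (use F in \<open>auto intro!: compact_imp_fmeasurable_lborel compact_Int\<close>)
      ultimately have "measure lborel (fatten (2 * r) F \<inter> closed_segment a y)
          \<le> measure lborel ((T - F) \<union> ((F \<inter> closed_segment x y) \<union> closed_segment a x))"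
        using compact_fatten [OF F, of "2 * r"]
        by (intro measure_mono_fmeasurable fmeasurable.Un) (auto simp: compact_imp_closed borel_closed)
      also have "\<dots> \<le> measure lborel (T - F) + measure lborel ((F \<inter> closed_segment x y) \<union> closed_segment a x)"
        using fin by (intro measure_Un_le) (auto intro: fmeasurableD)
      also have "\<dots> \<le> measure lborel (T - F) + (measure lborel (F \<inter> closed_segment x y) + measure lborel (closed_segment a x))"
        using fin by (intro add_left_mono measure_Un_le) (auto intro: fmeasurableD)
      also have "\<dots> \<le> \<eta> + (\<delta> * \<bar>y - x\<bar> + r)"
        using T_less Tb seg [OF x(1), of y] x(2)
        by (intro add_mono) (auto simp: measure_closed_segment_real abs_minus_commute)
      also have "\<dots> \<le> \<eta> + (\<delta> * (\<bar>y - a\<bar> + r) + r)"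
        using \<delta> x(2) by (intro add_left_mono add_right_mono mult_left_mono) auto
      also have "\<dots> \<le> \<delta> * \<bar>y - a\<bar> + (\<delta>' - \<delta>) * (d / 2)"
      proof -
        have "(\<delta>' - \<delta>) * (d / 2) = 2 * \<eta>" by (simp add: \<eta>_def)
        moreover have "\<delta> * (\<bar>y - a\<bar> + r) = \<delta> * \<bar>y - a\<bar> + \<delta> * r" by (simp add: distrib_left)
        ultimately show ?thesis using r\<eta> by linarith
      qed
      also have "\<dots> \<le> \<delta> * \<bar>y - a\<bar> + (\<delta>' - \<delta>) * \<bar>y - a\<bar>"
        using far \<delta> by (intro add_left_mono mult_left_mono) auto
      also have "\<dots> = \<delta>' * \<bar>y - a\<bar>" by (simp add: algebra_simps)
      finally show ?thesis .
    qed
  qed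
qed

section \<open>The bound for compact sets\<close>

lemma collinear_imp_line:
  fixes S :: "'a::euclidean_space set"
  assumes "collinear S" "a \<in> S"
  obtains u where "u \<noteq> 0" "\<And>x. x \<in> S \<Longrightarrow> \<exists>t. x = a + t *\<^sub>R u"
proof -
  obtain u0 where u0: "\<And>x y. x \<in> S \<Longrightarrow> y \<in> S \<Longrightarrow> \<exists>c. x - y = c *\<^sub>R u0"
    using assms(1) unfolding collinear_def by blast
  obtain e :: 'a where e: "e \<in> Basis" using nonempty_Basis by blast
  \<comment> \<open>A single point may come with direction zero; any nonzero vector then serves, and
    the coordinate along the line can be divided by \<open>u \<bullet> u\<close>.\<close>
  define u where "u = (if u0 = 0 then e else u0)"
  show thesis
  proof (rule that)
    show "u \<noteq> 0" using e by (auto simp: u_def)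
    fix x assume "x \<in> S"
    then obtain c where c: "x - a = c *\<^sub>R u0" using u0 assms(2) by blast
    show "\<exists>t. x = a + t *\<^sub>R u"
    proof (cases "u0 = 0")
      case True
      then show ?thesis using c by (intro exI [of _ 0]) simp
    next
      case False
      then show ?thesis using c by (intro exI [of _ c]) (simp add: u_def algebra_simps)
    qed
  qed
qed

text \<open>The affine parametrisation of the segment scales Lebesgue measure by |y - b|, also when
  the segment degenerates to a point. A fraction of parameters thus becomes a length.\<close>

lemma segment_fraction:
  fixes F :: "'a::euclidean_space set" and a u :: 'a
  assumes F: "closed F" and X: "closed X" "\<And>t. t \<in> X \<Longrightarrow> a + t *\<^sub>R u \<in> F"
    and le: "measure lebesgue {\<alpha> \<in> {0..1}. (1 - \<alpha>) *\<^sub>R (a + b *\<^sub>R u) + \<alpha> *\<^sub>R (a + y *\<^sub>R u) \<in> F} \<le> \<delta>"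
  shows "measure lborel (X \<inter> closed_segment b y) \<le> \<delta> * \<bar>y - b\<bar>"
proof -
  define Z where "Z = {\<alpha> \<in> {0..1}. (1 - \<alpha>) *\<^sub>R (a + b *\<^sub>R u) + \<alpha> *\<^sub>R (a + y *\<^sub>R u) \<in> F}"
  have "Z = {0..1} \<inter> (\<lambda>\<alpha>. (1 - \<alpha>) *\<^sub>R (a + b *\<^sub>R u) + \<alpha> *\<^sub>R (a + y *\<^sub>R u)) -` F"
    by (auto simp: Z_def)
  then have "compact Z"
    using F by (auto intro!: compact_Int_closed continuous_closed_vimage continuous_intros)
  have im: "compact ((\<lambda>\<alpha>. (y - b) *\<^sub>R \<alpha> + b) ` Z)"
    using \<open>compact Z\<close> by (intro compact_continuous_image continuous_intros)
  have "X \<inter> closed_segment b y \<subseteq> (\<lambda>\<alpha>. (y - b) *\<^sub>R \<alpha> + b) ` Z"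
  proof
    fix t assume t: "t \<in> X \<inter> closed_segment b y"
    then obtain \<alpha> where \<alpha>: "0 \<le> \<alpha>" "\<alpha> \<le> 1" "t = (1 - \<alpha>) * b + \<alpha> * y"
      by (auto simp: closed_segment_def)
    have "a + t *\<^sub>R u = (1 - \<alpha>) *\<^sub>R (a + b *\<^sub>R u) + \<alpha> *\<^sub>R (a + y *\<^sub>R u)"
      by (simp add: \<alpha>(3) algebra_simps)
    then have "\<alpha> \<in> Z" using X(2) [of t] t \<alpha> by (simp add: Z_def)
    then show "t \<in> (\<lambda>\<alpha>. (y - b) *\<^sub>R \<alpha> + b) ` Z"
      by (rule rev_image_eqI) (simp add: \<alpha>(3) algebra_simps)
  qed
  then have "measure lborel (X \<inter> closed_segment b y) \<le> measure lborel ((\<lambda>\<alpha>. (y - b) *\<^sub>R \<alpha> + b) ` Z)"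
    using X compact_imp_fmeasurable_lborel [OF im] by (intro measure_mono_fmeasurable) auto
  also have "\<dots> = measure lebesgue ((\<lambda>\<alpha>. (y - b) *\<^sub>R \<alpha> + b) ` Z)"
    using im by (simp add: compact_imp_closed borel_closed)
  also have "\<dots> = \<bar>y - b\<bar> * measure lebesgue Z"
    by (subst measure_lebesgue_affine) simp
  also have "\<dots> \<le> \<bar>y - b\<bar> * \<delta>"
    using le by (intro mult_left_mono) (simp_all add: Z_def)
  finally show ?thesis by (simp add: mult.commute)
qed

lemma compact_bound:
  fixes M :: "(real ^ 'n) measure"
  assumes "prob_space M" and M: "sets M = sets borel" and conc: "s_concave s M" and s: "s \<le> 1"
    and A: "compact A" "0 < measure M A" and F: "compact F" and disj: "A \<inter> F = {}" and "0 \<le> \<delta>"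
    and seg: "\<And>x y. x \<in> A \<Longrightarrow> measure lebesgue {\<alpha> \<in> {0..1}. (1 - \<alpha>) *\<^sub>R x + \<alpha> *\<^sub>R y \<in> F} \<le> \<delta>"
  shows "measure M F \<le> \<delta> * (- lg s (measure M A))"
proof (rule ccontr)
  interpret prob_space M by fact
  assume "\<not> measure M F \<le> \<delta> * (- lg s (measure M A))"
  then have neg: "\<delta> * (- lg s (measure M A)) < measure M F" by simp
  have AFb: "A \<in> sets borel" "F \<in> sets borel" using A F by (auto simp: compact_imp_closed)
  define p where "p = measure M A"
  have p: "0 < p" "p \<le> 1" using A by (auto simp: p_def)
  have phi0: "0 \<le> - lg s p" using lg_mono [OF p, of s] by simp
  have "0 \<le> \<delta> * (- lg s p)"
    using \<open>0 \<le> \<delta>\<close> phi0 by (rule mult_nonneg_nonneg)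
  then have F_pos: "0 < measure M F" using neg by (simp add: p_def)
  have "p + measure M F = measure M (A \<union> F)"
    using disj AFb unfolding p_def by (intro finite_measure_Union [symmetric]) (auto simp: M)
  \<comment> \<open>\<open>F\<close> is disjoint from \<open>A\<close> and has mass, so
    \<open>A\<close> does not carry everything; hence \<open>- lg s p\<close> is positive and may be
    divided by.\<close>
  then have "p < 1" using F_pos prob_le_1 [of "A \<union> F"] by linarith
  then have phi: "0 < - lg s p" using lg_strict_mono [OF p(1), of 1 s] by simp
  obtain \<kappa> where \<kappa>: "\<delta> * (- lg s p) < \<kappa>" "\<kappa> < measure M F"
    using dense [OF neg [folded p_def]] by blast
  define \<delta>' where "\<delta>' = \<kappa> / (- lg s p)"
  have \<delta>': "\<delta> < \<delta>'" "\<delta>' * (- lg s p) = \<kappa>"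
  proof -
    show "\<delta> < \<delta>'"
      unfolding \<delta>'_def pos_less_divide_eq [OF phi] by (rule \<kappa>(1))
    show "\<delta>' * (- lg s p) = \<kappa>" using phi by (simp add: \<delta>'_def)
  qed
  have "0 \<le> \<kappa>" using \<kappa>(1) \<open>0 \<le> \<delta> * (- lg s p)\<close> by linarith
  obtain R where "\<forall>x\<in>A \<union> F. norm x \<le> R"
    using compact_imp_bounded [OF compact_Un [OF A(1) F]] unfolding bounded_iff by blast
  then have R: "A \<union> F \<subseteq> cball 0 R" by auto
  have ball: "dense_body M A F p \<kappa> (cball 0 R)"
  proof -
    have "A \<inter> cball 0 R = A" "F \<inter> cball 0 R = F" using R by auto
    moreover have "p * measure M (cball 0 R) \<le> p" "\<kappa> * measure M (cball 0 R) \<le> \<kappa>"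
      using p \<open>0 \<le> \<kappa>\<close> by (auto intro!: mult_left_le)
    ultimately show ?thesis using \<kappa>(2) by (simp add: dense_body_def p_def)
  qed
  obtain S where S: "collinear S" "limit_body (dense_body M A F p \<kappa>) S"
    by (rule needle [OF assms(1) M conc AFb \<open>0 \<le> \<kappa>\<close> ball])
  have "S \<noteq> {}"
  proof
    assume "S = {}"
    then have "\<exists>C. dense_body M A F p \<kappa> C \<and> C \<subseteq> {}"
      using S(2) unfolding limit_body_def by (metis open_empty order_refl)
    then show False by (auto simp: dense_body_def)
  qed
  then obtain a where "a \<in> S" by blast
  obtain u where u: "u \<noteq> 0" "\<And>x. x \<in> S \<Longrightarrow> \<exists>t. x = a + t *\<^sub>R u"
    using collinear_imp_line [OF S(1) \<open>a \<in> S\<close>] by metis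
  \<comment> \<open>The coordinate of the orthogonal projection to the line of the needle, measured
    from a in units of u.\<close>
  define g where "g x = (u \<bullet> (x - a)) / (u \<bullet> u)" for x
  have g: "x = a + g x *\<^sub>R u" if "x \<in> S" for x
    using u(2) [OF that] u(1) by (auto simp: g_def)
  have gc: "continuous_on X g" for X
    unfolding g_def using u(1) by (intro continuous_intros) auto
  have ga: "g (\<alpha> *\<^sub>R x + (1 - \<alpha>) *\<^sub>R y) = \<alpha> * g x + (1 - \<alpha>) * g y" for \<alpha> x y
    using u(1) by (simp add: g_def inner_add_right inner_diff_right field_simps)
  define A' F' where "A' = g ` (A \<inter> S)" and "F' = g ` (F \<inter> S)"
  have "compact S" using S by (simp add: limit_body_def)
  then have cpt: "compact A'" "compact F'"
    using A F gc unfolding A'_def F'_def by (auto intro!: compact_continuous_image compact_Int)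
  have A'D: "a + t *\<^sub>R u \<in> A" if "t \<in> A'" for t
    using that g by (auto simp: A'_def)
  have F'D: "a + t *\<^sub>R u \<in> F" if "t \<in> F'" for t
    using that g by (auto simp: F'_def)
  have disj': "A' \<inter> F' = {}" using A'D F'D disj by blast
  have F'seg: "measure lborel (F' \<inter> closed_segment b y) \<le> \<delta> * \<bar>y - b\<bar>" if "b \<in> A'" for b y
    using F cpt F'D seg [OF A'D [OF that]] by (intro segment_fraction [of F]) (auto simp: compact_imp_closed)
  obtain r where r: "0 < r" "fatten r F' \<inter> fatten r A' = {}"
    "\<And>b y. b \<in> fatten r A' \<Longrightarrow> measure lborel (fatten (2 * r) F' \<inter> closed_segment b y) \<le> \<delta>' * \<bar>y - b\<bar>"
    using fatten_segments [OF cpt disj' \<open>0 \<le> \<delta>\<close> \<delta>'(1) F'seg] by metis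
  \<comment> \<open>The points whose membership in \<open>A\<close> or \<open>F\<close> forces their
    projection near the corresponding trace. This is an open neighbourhood of the needle, so it
    contains a dense body.\<close>
  define U where "U = - (A \<inter> g -` (- (\<Union>t\<in>A'. ball t r))) \<inter> - (F \<inter> g -` (- (\<Union>t\<in>F'. ball t r)))"
  have cl: "closed (g -` (- (\<Union>t\<in>X. ball t r)))" for X
    using gc [of UNIV] by (intro continuous_closed_vimage) (auto simp: continuous_on_eq_continuous_at)
  have "open U"
    unfolding U_def using cl A F by (intro open_Int open_Compl closed_Int) (auto simp: compact_imp_closed)
  moreover have "S \<subseteq> U"
  proof
    fix x assume "x \<in> S"
    then have "x \<in> A \<Longrightarrow> g x \<in> A'" "x \<in> F \<Longrightarrow> g x \<in> F'" by (auto simp: A'_def F'_def)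
    then have "x \<in> A \<Longrightarrow> g x \<in> (\<Union>t\<in>A'. ball t r)" "x \<in> F \<Longrightarrow> g x \<in> (\<Union>t\<in>F'. ball t r)"
      using r(1) by (auto intro!: bexI [of _ "g x"])
    then show "x \<in> U" by (auto simp: U_def)
  qed
  ultimately obtain C where C: "dense_body M A F p \<kappa> C" "C \<subseteq> U"
    using S(2) unfolding limit_body_def by blast
  have C': "compact C" "convex C" "0 < measure M C"
    using C dense_body_pos [OF C(1) \<open>0 \<le> \<kappa>\<close> finite_measure_axioms M] by (auto simp: dense_body_def)
  define N where "N = distr (uniform_measure M C) borel g"
  note N = pushforward_line_concave [OF assms(1) M conc C' gc ga, folded N_def]
  have part: "measure M (X \<inter> C) \<le> measure N (fatten r X') * measure M C"
    if "X \<inter> C \<subseteq> g -` (\<Union>t\<in>X'. ball t r)" "compact X'" for X X'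
  proof -
    have "g -` fatten r X' \<in> sets borel"
      using gc [of UNIV] compact_fatten [OF that(2), of r]
      by (intro borel_closed continuous_closed_vimage) (auto simp: continuous_on_eq_continuous_at compact_imp_closed)
    moreover have "(\<Union>t\<in>X'. ball t r) \<subseteq> fatten r X'"
      unfolding fatten_def by (intro UN_mono) auto
    then have "X \<inter> C \<subseteq> C \<inter> g -` fatten r X'" using that(1) by blast
    ultimately have "measure M (X \<inter> C) \<le> measure M (C \<inter> g -` fatten r X')"
      using C'(1) by (intro finite_measure_mono) (auto simp: M compact_imp_closed borel_closed)
    also have "\<dots> = measure N (fatten r X') * measure M C"
      using N(4) [of "fatten r X'"] C'(3) compact_fatten [OF that(2), of r]
      by (simp add: compact_imp_closed borel_closed)
    finally show ?thesis .
  qed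
  have "A \<inter> C \<subseteq> g -` (\<Union>t\<in>A'. ball t r)" "F \<inter> C \<subseteq> g -` (\<Union>t\<in>F'. ball t r)"
    using C(2) by (auto simp: U_def)
  note AC = part [OF this(1) cpt(1)] and FC = part [OF this(2) cpt(2)]
  have "p * measure M C \<le> measure N (fatten r A') * measure M C"
    using C(1) AC by (simp add: dense_body_def)
  then have NA: "p \<le> measure N (fatten r A')"
    using C'(3) by simp
  have "\<kappa> * measure M C < measure N (fatten r F') * measure M C"
    using C(1) FC by (simp add: dense_body_def)
  then have NF: "\<kappa> < measure N (fatten r F')"
    using C'(3) by simp
  \<comment> \<open>Fattening by \<open>2 * r\<close> supplies the margin r around
    \<open>fatten r F'\<close> that the inequality on the line requires.\<close>
  have "measure N (fatten r F') \<le> \<delta>' * (- lg s (measure N (fatten r A')))"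
  proof (rule line_bound [OF N(1-3) s _ _ _ r(2) _ r(1)])
    show "x \<in> fatten (2 * r) F'" if "w \<in> fatten r F'" "\<bar>w - x\<bar> \<le> r" for w x
    proof -
      obtain f where "f \<in> F'" "\<bar>w - f\<bar> \<le> r" using \<open>w \<in> fatten r F'\<close> by (auto simp: mem_fatten)
      with that(2) show ?thesis unfolding mem_fatten by (intro bexI [of _ f]) linarith+
    qed
  qed (use cpt NA p r(3) \<open>0 \<le> \<delta>\<close> \<delta>'(1) in \<open>auto simp: compact_fatten compact_imp_closed borel_closed\<close>)
  also have "\<dots> \<le> \<delta>' * (- lg s p)"
    using NA p \<open>0 \<le> \<delta>\<close> \<delta>'(1) by (intro mult_left_mono) (auto intro: lg_mono)
  finally show False using NF \<delta>'(2) by simp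
qed

section \<open>From compact sets to level sets of a Borel function\<close>

lemma esssup_tail_pos:
  fixes M :: "'a measure" and f :: "'a \<Rightarrow> real"
  assumes "prob_space M" and f: "f \<in> borel_measurable M" and l: "ereal l < esssup M (\<lambda>x. ereal \<bar>f x\<bar>)"
  shows "0 < measure M {x \<in> space M. l \<le> \<bar>f x\<bar>}"
proof (rule ccontr)
  interpret prob_space M by fact
  assume "\<not> ?thesis"
  then have "measure M {x \<in> space M. l \<le> \<bar>f x\<bar>} = 0"
    by (simp add: zero_less_measure_iff)
  moreover have "{x \<in> space M. l \<le> \<bar>f x\<bar>} \<in> sets M" using f by measurable
  ultimately have "{x \<in> space M. l \<le> \<bar>f x\<bar>} \<in> null_sets M"
    by (simp add: null_sets_def emeasure_eq_measure)
  then have "AE x in M. ereal \<bar>f x\<bar> \<le> ereal l"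
    by (rule AE_I') auto
  then have "esssup M (\<lambda>x. ereal \<bar>f x\<bar>) \<le> ereal l"
    using f by (intro esssup_I) measurable
  then show False using l by simp
qed

lemma compact_exhaustion:
  fixes M :: "'a::{second_countable_topology, complete_space} measure"
  assumes "finite_measure M" and M: "sets M = sets borel" and B: "B \<in> sets borel"
  obtains K where "\<And>n::nat. compact (K n)" "\<And>n. K n \<subseteq> B" "(\<lambda>n. measure M (K n)) \<longlonglongrightarrow> measure M B"
proof -
  interpret finite_measure M by fact
  have sp: "space M = UNIV" using sets_eq_imp_space_eq [OF M] by simp
  have "\<exists>K. compact K \<and> K \<subseteq> B \<and> measure M B - 1 / Suc n \<le> measure M K" for n
  proof (cases "measure M B = 0")
    case True
    then show ?thesis by (intro exI [of _ "{}"]) simp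
  next
    case False
    then have "ennreal (measure M B - 1 / Suc n) < ennreal (measure M B)"
      by (intro ennreal_lessI) (auto simp: zero_less_measure_iff)
    also have "\<dots> = (SUP K \<in> {K. K \<subseteq> B \<and> compact K}. emeasure M K)"
      using inner_regular [OF M _ B] by (simp add: emeasure_eq_measure)
    finally obtain K where K: "K \<subseteq> B" "compact K" "ennreal (measure M B - 1 / Suc n) < emeasure M K"
      by (auto simp: less_SUP_iff)
    then have "measure M B - 1 / Suc n < measure M K"
      unfolding emeasure_eq_measure by (metis ennreal_leI not_le)
    then show ?thesis using K by (intro exI [of _ K]) simp
  qed
  then obtain K where K: "\<And>n. compact (K n)" "\<And>n. K n \<subseteq> B" "\<And>n. measure M B - 1 / Suc n \<le> measure M (K n)"
    by metis
  have "(\<lambda>n. measure M (K n)) \<longlonglongrightarrow> measure M B"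
  proof (rule tendsto_sandwich)
    show "(\<lambda>n. measure M B - 1 / Suc n) \<longlonglongrightarrow> measure M B"
      using tendsto_diff [OF tendsto_const LIMSEQ_Suc [OF lim_1_over_n], of "measure M B"] by simp
    show "\<forall>\<^sub>F n in sequentially. measure M (K n) \<le> measure M B"
      using K(2) B by (intro always_eventually allI finite_measure_mono) (auto simp: M)
  qed (use K(3) in auto)
  with K(1,2) show thesis by (rule that)
qed

lemma fraction_measurable:
  fixes f :: "real ^ 'n \<Rightarrow> real"
  assumes f: "f \<in> borel_measurable borel"
  shows "{\<alpha> \<in> {0..1}. \<bar>f ((1 - \<alpha>) *\<^sub>R x + \<alpha> *\<^sub>R y)\<bar> \<le> c} \<in> sets borel"
proof -
  have "(\<lambda>\<alpha>. (1 - \<alpha>) *\<^sub>R x + \<alpha> *\<^sub>R y) \<in> borel_measurable borel"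
    by (intro borel_measurable_continuous_onI continuous_intros)
  note [measurable] = measurable_compose [OF this f]
  have "{\<alpha> \<in> space borel. \<alpha> \<in> {0..1} \<and> \<bar>f ((1 - \<alpha>) *\<^sub>R x + \<alpha> *\<^sub>R y)\<bar> \<le> c} \<in> sets borel"
    by measurable
  then show ?thesis by simp
qed

lemma regularity_modulus_upper:
  fixes f :: "real ^ 'n \<Rightarrow> real"
  assumes f: "f \<in> borel_measurable borel"
  shows "measure lebesgue {\<alpha> \<in> {0..1}. \<bar>f ((1 - \<alpha>) *\<^sub>R x + \<alpha> *\<^sub>R y)\<bar> \<le> \<epsilon> * \<bar>f x\<bar>} \<le> regularity_modulus f \<epsilon>"
proof -
  have *: "measure lebesgue {\<alpha> \<in> {0..1}. \<bar>f ((1 - \<alpha>) *\<^sub>R x + \<alpha> *\<^sub>R y)\<bar> \<le> \<epsilon> * \<bar>f x\<bar>} \<le> 1" for x y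
  proof -
    have "measure lebesgue {\<alpha> \<in> {0..1}. \<bar>f ((1 - \<alpha>) *\<^sub>R x + \<alpha> *\<^sub>R y)\<bar> \<le> \<epsilon> * \<bar>f x\<bar>}
        \<le> measure lebesgue {0..1::real}"
    proof (rule measure_mono_fmeasurable)
      show "{\<alpha> \<in> {0..1}. \<bar>f ((1 - \<alpha>) *\<^sub>R x + \<alpha> *\<^sub>R y)\<bar> \<le> \<epsilon> * \<bar>f x\<bar>} \<in> sets lebesgue"
        by (intro sets_completionI_sets) (simp only: sets_lborel fraction_measurable [OF f])
      show "{0..1::real} \<in> lmeasurable" by simp
    qed blast
    also have "measure lebesgue {0..1::real} = 1" by simp
    finally show ?thesis .
  qed
  define m where "m = (\<lambda>(x, y). measure lebesgue {\<alpha> \<in> {0..1}. \<bar>f ((1 - \<alpha>) *\<^sub>R x + \<alpha> *\<^sub>R y)\<bar> \<le> \<epsilon> * \<bar>f x\<bar>})"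
  have "m z \<le> 1" for z
    using * [of "fst z" "snd z"] unfolding m_def case_prod_unfold .
  then have "bdd_above (range m)"
    by (rule bdd_aboveI2)
  then have "m (x, y) \<le> (SUP z\<in>UNIV. m z)"
    by (intro cSUP_upper UNIV_I)
  then show ?thesis
    unfolding regularity_modulus_def m_def prod.case .
qed

text \<open>Tail and sublevel set are exhausted by compact sets from inside, and both sides pass to
  the limit because \<open>lg s\<close> is continuous at the positive mass of the tail. The compact
  sets must be disjoint, so the overlap has to be null: for l > 0 and \<epsilon> < 1 it is empty,
  and \<open>boundary\<close> covers the remaining cases with l \<ge> 0.\<close>

lemma sublevel_bound:
  fixes f :: "real ^ 'n \<Rightarrow> real" and M :: "(real ^ 'n) measure"
  assumes f: "f \<in> borel_measurable borel"
    and "0 < \<epsilon>" and "\<epsilon> \<le> 1" and s: "s \<le> 1"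
    and "prob_space M" and M: "sets M = sets borel" and conc: "s_concave s M"
    and l: "ereal l < esssup M (\<lambda>x. ereal \<bar>f x\<bar>)"
    and boundary: "l = 0 \<or> \<epsilon> = 1 \<Longrightarrow> measure M {x. \<bar>f x\<bar> = l} = 0"
  shows "measure M {x. \<bar>f x\<bar> \<le> l * \<epsilon>} \<le> regularity_modulus f \<epsilon> * (- lg s (measure M {x. l \<le> \<bar>f x\<bar>}))"
proof -
  interpret prob_space M by fact
  have sp: "space M = UNIV" using sets_eq_imp_space_eq [OF M] by simp
  have fM: "f \<in> borel_measurable M" using f by (simp add: measurable_def sp M)
  define A where "A = {x. l \<le> \<bar>f x\<bar>}"
  define B where "B = {x. \<bar>f x\<bar> \<le> l * \<epsilon>}"
  have pre: "{x. \<bar>f x\<bar> \<in> X} \<in> sets borel" if "X \<in> sets borel" for X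
    using measurable_sets [OF borel_measurable_abs [OF f] that] by (simp add: vimage_def)
  have Ab: "A \<in> sets borel" and Bb: "B \<in> sets borel"
    using pre [of "{l..}"] pre [of "{..l * \<epsilon>}"] by (simp_all add: A_def B_def)
  have A_pos: "0 < measure M A"
    using esssup_tail_pos [OF \<open>prob_space M\<close> fM l] by (simp add: A_def sp)
  define \<delta> where "\<delta> = regularity_modulus f \<epsilon>"
  have \<delta>0: "0 \<le> \<delta>"
    unfolding \<delta>_def using regularity_modulus_upper [OF f] measure_nonneg by (rule order_trans [rotated])
  have phi: "0 \<le> - lg s (measure M A)"
    using lg_mono [OF A_pos, of 1 s] by simp
  show ?thesis
    unfolding A_def [symmetric] B_def [symmetric] \<delta>_def [symmetric]
  proof (cases "l < 0")
    case True
    then have "l * \<epsilon> < 0" using \<open>0 < \<epsilon>\<close> by (simp add: mult_neg_pos)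
    then have "B = {}" by (auto simp: B_def)
    then show "measure M B \<le> \<delta> * (- lg s (measure M A))"
      using mult_nonneg_nonneg [OF \<delta>0 phi] by simp
  next
    case False
    have "measure M (A \<inter> B) = 0"
    proof (cases "l = 0 \<or> \<epsilon> = 1")
      case True
      have "A \<inter> B \<subseteq> {x. \<bar>f x\<bar> = l}" using True by (auto simp: A_def B_def)
      moreover have "{x. \<bar>f x\<bar> = l} \<in> sets M" using pre [of "{l}"] by (simp add: M)
      ultimately have "measure M (A \<inter> B) \<le> measure M {x. \<bar>f x\<bar> = l}" by (rule finite_measure_mono)
      then show ?thesis using boundary [OF True] by (simp add: measure_le_0_iff)
    next
      case 2: False
      then have "l * \<epsilon> < l * 1" using False \<open>\<epsilon> \<le> 1\<close> by (intro mult_strict_left_mono) auto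
      then have "A \<inter> B = {}" by (auto simp: A_def B_def)
      then show ?thesis by simp
    qed
    moreover have "measure M B = measure M (B - A) + measure M (A \<inter> B)"
    proof -
      have "(B - A) \<inter> (A \<inter> B) = {}" "(B - A) \<union> (A \<inter> B) = B" by auto
      then show ?thesis
        using finite_measure_Union [of "B - A" "A \<inter> B"] Ab Bb by (simp add: M)
    qed
    ultimately have BA: "measure M B = measure M (B - A)" by simp
    obtain K where K: "\<And>n::nat. compact (K n)" "\<And>n. K n \<subseteq> A" "(\<lambda>n. measure M (K n)) \<longlonglongrightarrow> measure M A"
      using compact_exhaustion [OF finite_measure_axioms M Ab] by metis
    have "B - A \<in> sets borel" using Ab Bb by simp
    then obtain L where L: "\<And>n::nat. compact (L n)" "\<And>n. L n \<subseteq> B - A" "(\<lambda>n. measure M (L n)) \<longlonglongrightarrow> measure M (B - A)"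
      using compact_exhaustion [OF finite_measure_axioms M] by metis
    have "measure M (B - A) \<le> \<delta> * (- lg s (measure M A))"
    proof (rule tendsto_le [OF sequentially_bot _ L(3)])
      show "(\<lambda>n. \<delta> * (- lg s (measure M (K n)))) \<longlonglongrightarrow> \<delta> * (- lg s (measure M A))"
        by (intro tendsto_intros isCont_tendsto_compose [OF continuous_lg [OF A_pos]] K(3))
      have "\<forall>\<^sub>F n in sequentially. 0 < measure M (K n)"
        using order_tendstoD(1) [OF K(3) A_pos] .
      then show "\<forall>\<^sub>F n in sequentially. measure M (L n) \<le> \<delta> * (- lg s (measure M (K n)))"
      proof (rule eventually_mono)
        fix n assume n: "0 < measure M (K n)"
        show "measure M (L n) \<le> \<delta> * (- lg s (measure M (K n)))"
        proof (rule compact_bound [OF \<open>prob_space M\<close> M conc s K(1) n L(1) _ \<delta>0])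
          show "K n \<inter> L n = {}" using K(2) L(2) by blast
          fix x y assume "x \<in> K n"
          \<comment> \<open>From a starting point in the tail, the part of the segment in the
            sublevel set lies in the set measured by the modulus.\<close>
          then have "l \<le> \<bar>f x\<bar>" using K(2) by (auto simp: A_def)
          then have "l * \<epsilon> \<le> \<epsilon> * \<bar>f x\<bar>" using \<open>0 < \<epsilon>\<close> by (simp add: mult.commute)
          have "measure lebesgue {\<alpha> \<in> {0..1}. (1 - \<alpha>) *\<^sub>R x + \<alpha> *\<^sub>R y \<in> L n}
              \<le> measure lebesgue {\<alpha> \<in> {0..1}. \<bar>f ((1 - \<alpha>) *\<^sub>R x + \<alpha> *\<^sub>R y)\<bar> \<le> \<epsilon> * \<bar>f x\<bar>}"
          proof (rule measure_mono_fmeasurable)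
            show "{\<alpha> \<in> {0..1}. (1 - \<alpha>) *\<^sub>R x + \<alpha> *\<^sub>R y \<in> L n}
                \<subseteq> {\<alpha> \<in> {0..1}. \<bar>f ((1 - \<alpha>) *\<^sub>R x + \<alpha> *\<^sub>R y)\<bar> \<le> \<epsilon> * \<bar>f x\<bar>}"
            proof
              fix \<alpha> assume "\<alpha> \<in> {\<alpha> \<in> {0..1}. (1 - \<alpha>) *\<^sub>R x + \<alpha> *\<^sub>R y \<in> L n}"
              then have "\<alpha> \<in> {0..1}" "(1 - \<alpha>) *\<^sub>R x + \<alpha> *\<^sub>R y \<in> B" using L(2) [of n] by auto
              then show "\<alpha> \<in> {\<alpha> \<in> {0..1}. \<bar>f ((1 - \<alpha>) *\<^sub>R x + \<alpha> *\<^sub>R y)\<bar> \<le> \<epsilon> * \<bar>f x\<bar>}"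
                using \<open>l * \<epsilon> \<le> \<epsilon> * \<bar>f x\<bar>\<close> by (simp add: B_def)
            qed
            have "closed ((\<lambda>\<alpha>. (1 - \<alpha>) *\<^sub>R x + \<alpha> *\<^sub>R y) -` L n)"
              using L(1) by (intro continuous_closed_vimage continuous_intros compact_imp_closed)
            then have "closed ({0..1} \<inter> (\<lambda>\<alpha>. (1 - \<alpha>) *\<^sub>R x + \<alpha> *\<^sub>R y) -` L n)"
              by (intro closed_Int) auto
            moreover have "{\<alpha> \<in> {0..1}. (1 - \<alpha>) *\<^sub>R x + \<alpha> *\<^sub>R y \<in> L n}
                = {0..1} \<inter> (\<lambda>\<alpha>. (1 - \<alpha>) *\<^sub>R x + \<alpha> *\<^sub>R y) -` L n" by auto
            ultimately show "{\<alpha> \<in> {0..1}. (1 - \<alpha>) *\<^sub>R x + \<alpha> *\<^sub>R y \<in> L n} \<in> sets lebesgue"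
              by (simp add: borel_closed)
            have "bounded {\<alpha> \<in> {0..1}. \<bar>f ((1 - \<alpha>) *\<^sub>R x + \<alpha> *\<^sub>R y)\<bar> \<le> \<epsilon> * \<bar>f x\<bar>}"
              by (rule bounded_subset [of "{0..1}"]) auto
            then show "{\<alpha> \<in> {0..1}. \<bar>f ((1 - \<alpha>) *\<^sub>R x + \<alpha> *\<^sub>R y)\<bar> \<le> \<epsilon> * \<bar>f x\<bar>} \<in> lmeasurable"
              using fraction_measurable [OF f, of x y] by (intro bounded_set_imp_lmeasurable) simp_all
          qed
          also have "\<dots> \<le> \<delta>"
            unfolding \<delta>_def by (rule regularity_modulus_upper [OF f])
          finally show "measure lebesgue {\<alpha> \<in> {0..1}. (1 - \<alpha>) *\<^sub>R x + \<alpha> *\<^sub>R y \<in> L n} \<le> \<delta>" .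
        qed
      qed
    qed
    then show "measure M B \<le> \<delta> * (- lg s (measure M A))" using BA by simp
  qed
qed

text \<open>The assumption \<open>boundary\<close> excludes genuine failures. For l = 0 the tail is
  the whole space and the right side is zero, while the left side is the mass of the zero set. For
  \<epsilon> = 1 the same happens when |f| takes exactly two values, l and a larger one, each with
  positive mass. The comparison with the essential supremum is made in \<open>ereal\<close> because
  it may be infinite.\<close>

theorem corollary8:
  fixes f :: "real ^ 'n \<Rightarrow> real" and M :: "(real ^ 'n) measure"
    and s \<epsilon> l :: real
  assumes "f \<in> borel_measurable borel"
    and "0 < \<epsilon>" and "\<epsilon> \<le> 1"
    and "s \<le> 1"
    and "prob_space M" and "sets M = sets borel" and "s_concave s M"
    and "ereal l < esssup M (\<lambda>x. ereal \<bar>f x\<bar>)"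
    and boundary: "l = 0 \<or> \<epsilon> = 1 \<Longrightarrow> measure M {x. \<bar>f x\<bar> = l} = 0"
  shows "(s \<noteq> 0 \<longrightarrow> measure M {x. \<bar>f x\<bar> \<le> l * \<epsilon>}
            \<le> regularity_modulus f \<epsilon> * ((1 - measure M {x. \<bar>f x\<bar> \<ge> l} powr s) / s))
       \<and> (s = 0 \<longrightarrow> measure M {x. \<bar>f x\<bar> \<le> l * \<epsilon>}
            \<le> regularity_modulus f \<epsilon> * ln (1 / measure M {x. \<bar>f x\<bar> \<ge> l}))"
proof -
  interpret prob_space M by fact
  have sp: "space M = UNIV" using sets_eq_imp_space_eq [OF assms(6)] by simp
  have "f \<in> borel_measurable M" using assms(1) by (simp add: measurable_def sp assms(6))
  then have pos: "0 < measure M {x. l \<le> \<bar>f x\<bar>}"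
    using esssup_tail_pos [OF assms(5) _ assms(8)] by (simp add: sp)
  note bound = sublevel_bound [OF assms]
  show ?thesis
  proof (intro conjI impI)
    assume "s \<noteq> 0"
    then have "- lg s (measure M {x. l \<le> \<bar>f x\<bar>}) = (1 - measure M {x. l \<le> \<bar>f x\<bar>} powr s) / s"
      by (simp add: lg_def field_simps)
    with bound show "measure M {x. \<bar>f x\<bar> \<le> l * \<epsilon>}
        \<le> regularity_modulus f \<epsilon> * ((1 - measure M {x. \<bar>f x\<bar> \<ge> l} powr s) / s)" by (simp only:)
  next
    assume "s = 0"
    then have "- lg s (measure M {x. l \<le> \<bar>f x\<bar>}) = ln (1 / measure M {x. l \<le> \<bar>f x\<bar>})"
      using pos by (simp add: lg_def ln_div)
    with bound show "measure M {x. \<bar>f x\<bar> \<le> l * \<epsilon>}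
        \<le> regularity_modulus f \<epsilon> * ln (1 / measure M {x. \<bar>f x\<bar> \<ge> l})" by (simp only:)
  qed
qed

end
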